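(* Let $W$ be a kernel and $g\in L_\infty([0,1])$, and let $u$ be the solution of the continuum voting model with kernel $W$ and initial condition $g$. For each positive integer $n$ let $u_n$ be the solution of the $n$-th approximate problem, i.e. of the continuum voting model with the step kernel $W_n$ and step initial condition $g_n$ obtained from $W$ and $g$ by averaging (as defined in the context). Suppose that $u$ reaches consensus on $[0,1]$, and let $D$ be any positive real number. Then for every $\varepsilon>0$ and every $c>0$ there exist $T=T(\varepsilon)$ and, for each $t\in[T,T+D]$, a subset $S_t\subseteq[0,1]^2$ with $\lambda(S_t)<c^2$ such that for all sufficiently large $n$, $$|u_n(x,t)-u_n(y,t)|\le \varepsilon\qquad\text{for all }(x,y)\in[0,1]^2\setminus S_t\text{ and }t\in[T,T+D].$$
   Context: $\lambda$ denotes Lebesgue measure. A kernel is a symmetric measurable function $W:[0,1]^2\to[-1,1]$. Continuum voting model with kernel $W$ and initial condition $g\in L_\infty([0,1])$: the initial value problem $$\frac{\partial u(x,t)}{\partial t}=\int_0^1 W(x,y)\big(u(y,t)-u(x,t)\big)\,dy\quad (x\in[0,1],\ t>0),\qquad u(\cdot,0)=g.$$ It has a unique solution in $C^1(\mathbb{R},L_\infty([0,1]))$, and "the solution" always means this one. Approximate problems: let $I_1^n=[0,\frac1n]$ and $I_i^n=(\frac{i-1}{n},\frac in]$ for $2\le i\le n$. Put $\beta^n_{ij}=n^2\int_{I_i^n\times I_j^n}W(x,y)\,dx\,dy$, and define the step kernel $W_n(x,y)=\beta^n_{ij}$ for $(x,y)\in I_i^n\times I_j^n$ and the step function $g_n(x)=n\int_{I_i^n}g(y)\,dy$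 for $x\in I_i^n$. The solution $u_n$ is equivalently given by $u_n(x,t)=u_i^n(t)$ for $x\in I_i^n$, where $\frac{du_i^n}{dt}=\frac1n\sum_{j=1}^n\beta_{ij}^n(u_j^n-u_i^n)$ and $u_i^n(0)$ is the value of $g_n$ on $I_i^n$ ($i=1,\dots,n$). Consensus on a set $A\subseteq[0,1]$ of nonzero measure is attained (reached) by $u$ if $\lim_{t\to\infty}\operatorname{ess\,sup}_{(x,y)\in A^2}|u(x,t)-u(y,t)|=0$. *)

theory Defs
  imports "HOL-Probability.Essential_Supremum"
begin

definition voting_kernel :: "(real \<Rightarrow> real \<Rightarrow> real) \<Rightarrow> bool" where
  "voting_kernel W \<longleftrightarrow>
     (\<lambda>(x, y). W x y) \<in> borel_measurable (lebesgue_on ({0..1} \<times> {0..1})) \<and>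
     (\<forall>x\<in>{0..1}. \<forall>y\<in>{0..1}. W x y = W y x \<and> W x y \<in> {-1..1})"

text \<open>Elements of \<open>L\<^sub>\<infinity>([0,1])\<close> are represented by functions on the reals of which only the
  values on \<open>[0,1]\<close> matter, up to null sets; convergence is in the essential supremum seminorm.\<close>

definition Linf_norm :: "(real \<Rightarrow> real) \<Rightarrow> ereal" where
  "Linf_norm f = esssup (lebesgue_on {0..1}) (\<lambda>x. ereal \<bar>f x\<bar>)"

definition Linf :: "(real \<Rightarrow> real) set" where
  "Linf = {f \<in> borel_measurable (lebesgue_on {0..1}). Linf_norm f < \<infinity>}"

text \<open>The curve \<open>t \<mapsto> u(\<cdot>,t)\<close> belongs to \<open>C\<^sup>1(\<real>, L\<^sub>\<infinity>([0,1]))\<close>, with derivative \<open>t \<mapsto> v(\<cdot>,t)\<close>.\<close>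

definition C1_Linf :: "(real \<Rightarrow> real \<Rightarrow> real) \<Rightarrow> (real \<Rightarrow> real \<Rightarrow> real) \<Rightarrow> bool" where
  "C1_Linf u v \<longleftrightarrow>
     (\<forall>t. (\<lambda>x. u x t) \<in> Linf \<and> (\<lambda>x. v x t) \<in> Linf) \<and>
     (\<forall>t. ((\<lambda>h. Linf_norm (\<lambda>x. (u x (t + h) - u x t) / h - v x t)) \<longlongrightarrow> 0) (at 0)) \<and>
     (\<forall>t. ((\<lambda>s. Linf_norm (\<lambda>x. v x s - v x t)) \<longlongrightarrow> 0) (at t))"

text \<open>The equation is imposed for \<open>t > 0\<close> only, so the solution is determined (as a curve in
  \<open>L\<^sub>\<infinity>\<close>) on \<open>[0,\<infinity>)\<close>; its values at negative times are immaterial. Every choice of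
  representatives \<open>u(\<cdot>,t)\<close> of the solution is allowed.\<close>

definition voting_solution ::
    "(real \<Rightarrow> real \<Rightarrow> real) \<Rightarrow> (real \<Rightarrow> real) \<Rightarrow> (real \<Rightarrow> real \<Rightarrow> real) \<Rightarrow> bool" where
  "voting_solution W g u \<longleftrightarrow>
     (\<exists>v. C1_Linf u v \<and>
        (\<forall>t>0. AE x in lebesgue_on {0..1}.
            v x t = (LINT y|lebesgue_on {0..1}. W x y * (u y t - u x t)))) \<and>
     (AE x in lebesgue_on {0..1}. u x 0 = g x)"

definition cell :: "nat \<Rightarrow> nat \<Rightarrow> real set" where
  "cell n i = (if i = 1 then {0..1 / real n} else {(real i - 1) / real n<..real i / real n})"

definition step_coeff :: "(real \<Rightarrow> real \<Rightarrow> real) \<Rightarrow> nat \<Rightarrow> nat \<Rightarrow> nat \<Rightarrow> real" where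
  "step_coeff W n i j =
     (real n)\<^sup>2 * (LINT p|lebesgue_on (cell n i \<times> cell n j). W (fst p) (snd p))"

text \<open>The cells \<open>1, \<dots>, n\<close> partition \<open>[0,1]\<close>, so on \<open>[0,1]\<close> exactly one summand survives below.\<close>

definition step_kernel :: "(real \<Rightarrow> real \<Rightarrow> real) \<Rightarrow> nat \<Rightarrow> real \<Rightarrow> real \<Rightarrow> real" where
  "step_kernel W n x y =
     (\<Sum>i=1..n. \<Sum>j=1..n. step_coeff W n i j * indicator (cell n i) x * indicator (cell n j) y)"

definition step_fun :: "(real \<Rightarrow> real) \<Rightarrow> nat \<Rightarrow> real \<Rightarrow> real" where
  "step_fun g n x =
     (\<Sum>i=1..n. real n * (LINT y|lebesgue_on (cell n i). g y) * indicator (cell n i) x)"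

definition reaches_consensus :: "(real \<Rightarrow> real \<Rightarrow> real) \<Rightarrow> real set \<Rightarrow> bool" where
  "reaches_consensus u A \<longleftrightarrow>
     ((\<lambda>t. esssup (lebesgue_on (A \<times> A)) (\<lambda>(x, y). ereal \<bar>u x t - u y t\<bar>)) \<longlongrightarrow> 0) at_top"

end

(* The operator F p (x) = \<integral> W(x,y) (p(y) - p(x)) dy has norm at most 2 on L-infinity, so the solution is
   u(t) = \<Sum>\<^sub>k t^k / k! F^k g, and the tail of this series is small in L-infinity, uniformly for t in a
   bounded interval and also uniformly over the approximate problems. It therefore suffices to compare
   finitely many terms F_n^k g_n and F^k g. With A_n the averaging over the cells of the n-th partition and
   T p (x) = \<integral> W(x,y) p(y) dy, one has T_n = A_n T A_n for the step kernel; since A_n f \<longlonglongrightarrow> f almost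
   everywhere by Lebesgue differentiation, induction on k gives F_n^k g_n \<longlonglongrightarrow> F^k g almost everywhere.
   Egorov's argument makes the convergence uniform off a small set that depends neither on n nor on t;
   for each t only the null sets coming from the choice of representatives are added to it. *)

theory Submission
  imports Defs "HOL-Probability.Probability_Measure"
begin

subsection \<open>Bounded kernels on a probability space\<close>

text \<open>Several obstacles shape the argument. Representatives of \<open>u(.,t)\<close> may be
  chosen independently for each \<open>t\<close>, so nothing is known about
  \<open>t \<mapsto> u x t\<close> at a fixed \<open>x\<close>; the equation is therefore used only
  after integration over measurable sets. The bound of a solution on a time interval may depend on
  \<open>n\<close>; it is removed by letting the number of Taylor terms tend to infinity at fixed
  \<open>t\<close>, which leaves a tail controlled by the bound of \<open>g\<close> alone. The
  operator F does not smooth, because of the term \<open>- p(x) * T 1 (x)\<close>, but T is bounded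
  from L1 into the bounded functions; this is why almost everywhere convergence of bounded functions
  survives each application of F. Finally \<open>W\<close> is only Lebesgue measurable on the
  square, so its sections are under control only for almost every \<open>x\<close>; it is replaced
  by a Borel kernel bounded everywhere. The order of choices decides the quantifiers: the time from
  \<epsilon> and consensus, then the truncation order, then the Egorov set from \<open>c\<close>,
  and last the null sets from \<open>t\<close>.\<close>

definition ess_bdd :: "'a measure \<Rightarrow> real \<Rightarrow> ('a \<Rightarrow> real) \<Rightarrow> bool" where
  "ess_bdd M B p \<longleftrightarrow> p \<in> borel_measurable M \<and> (AE x in M. \<bar>p x\<bar> \<le> B)"

lemma ess_bdd_measurable [measurable_dest]: "ess_bdd M B p \<Longrightarrow> p \<in> borel_measurable M"
  by (simp add: ess_bdd_def)

lemma ess_bdd_mono: "ess_bdd M B p \<Longrightarrow> B \<le> C \<Longrightarrow> ess_bdd M C p"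
  by (auto simp: ess_bdd_def elim: eventually_mono)

lemma ess_bdd_scale: "ess_bdd M B p \<Longrightarrow> ess_bdd M (\<bar>c\<bar> * B) (\<lambda>x. c * p x)"
  by (auto simp: ess_bdd_def abs_mult elim!: eventually_mono intro!: mult_left_mono)

lemma ess_bdd_add: "ess_bdd M B p \<Longrightarrow> ess_bdd M C q \<Longrightarrow> ess_bdd M (B + C) (\<lambda>x. p x + q x)"
  by (auto simp: ess_bdd_def)

lemma ess_bdd_diff: "ess_bdd M B p \<Longrightarrow> ess_bdd M C q \<Longrightarrow> ess_bdd M (B + C) (\<lambda>x. p x - q x)"
  by (auto simp: ess_bdd_def)

lemma (in finite_measure) ess_bdd_integrable: "ess_bdd M B p \<Longrightarrow> integrable M p"
  by (auto simp: ess_bdd_def intro!: integrable_const_bound[where B = B])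

lemma (in prob_space) ess_bdd_nonneg: "ess_bdd M B p \<Longrightarrow> 0 \<le> B"
proof -
  assume "ess_bdd M B p"
  then have "AE x in M. \<bar>p x\<bar> \<le> B" by (simp add: ess_bdd_def)
  then have "AE x in M. 0 \<le> B" by eventually_elim linarith
  then show ?thesis by simp
qed

section \<open>Bounds from integrals over sets, mean convergence, and Egorov's argument\<close>

lemma integrable_indicator_mult:
  fixes f :: "'a \<Rightarrow> real"
  shows "integrable M f \<Longrightarrow> E \<in> sets M \<Longrightarrow> integrable M (\<lambda>x. indicator E x * f x)"
  using integrable_mult_indicator[of E M f] by simp

text \<open>Testing on the set where the bound fails forces that set to be null. This is the way
  back from scalar estimates to essential bounds; \<open>abs_set_integral_le_ess_bdd\<close> is the
  way there.\<close>

lemma (in finite_measure) AE_abs_le_of_set_integrals: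
  fixes f :: "'a \<Rightarrow> real"
  assumes f: "integrable M f"
    and le: "\<And>E. E \<in> sets M \<Longrightarrow> \<bar>LINT x:E|M. f x\<bar> \<le> c * measure M E"
  shows "AE x in M. \<bar>f x\<bar> \<le> c"
proof -
  have upper: "AE x in M. h x \<le> c"
    if h: "integrable M h" "\<And>E. E \<in> sets M \<Longrightarrow> (LINT x:E|M. h x) \<le> c * measure M E"
    for h :: "'a \<Rightarrow> real"
  proof -
    have [measurable]: "h \<in> borel_measurable M" using h by auto
    define E where "E = {x \<in> space M. c < h x}"
    have E[measurable]: "E \<in> sets M" unfolding E_def by measurable
    let ?q = "\<lambda>x. indicator E x * (h x - c)"
    note int = integrable_indicator_mult[OF h(1) E] integrable_indicator_mult[OF integrable_const E, of c]
    \<comment> \<open>\<open>?q\<close> is nonnegative, and the hypothesis on \<open>E\<close> makes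
      its integral nonpositive, so it vanishes almost everywhere.\<close>
    have q: "integrable M ?q" using int by (simp add: right_diff_distrib)
    have "integral\<^sup>L M ?q = (LINT x:E|M. h x) - c * measure M E"
      using int by (simp add: right_diff_distrib set_lebesgue_integral_def)
    then have "integral\<^sup>L M ?q \<le> 0" using h(2)[OF E] by simp
    moreover have nn: "AE x in M. 0 \<le> ?q x" by (auto simp: E_def indicator_def)
    ultimately have "integral\<^sup>L M ?q = 0" using integral_nonneg_AE[OF nn] by simp
    then have "AE x in M. ?q x = 0" using integral_nonneg_eq_0_iff_AE[OF q nn] by simp
    with AE_space show ?thesis
      by eventually_elim (auto simp: E_def indicator_def split: if_splits)
  qed
  have "AE x in M. f x \<le> c" using f le by (intro upper) (auto simp: abs_le_iff)
  moreover have "AE x in M. - f x \<le> c"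
    using f le by (intro upper) (auto simp: abs_le_iff set_lebesgue_integral_def)
  ultimately show ?thesis by eventually_elim auto
qed

lemma (in finite_measure) abs_set_integral_le_ess_bdd:
  assumes p: "ess_bdd M B p" and E: "E \<in> sets M"
  shows "\<bar>LINT x:E|M. p x\<bar> \<le> B * measure M E"
proof -
  have ip: "integrable M p" using p by (rule ess_bdd_integrable)
  have "\<bar>LINT x:E|M. p x\<bar> \<le> (LINT x|M. \<bar>indicator E x * p x\<bar>)"
    unfolding set_lebesgue_integral_def by simp
  also have "\<dots> \<le> (LINT x|M. indicator E x * B)"
  proof (rule integral_mono_AE)
    show "integrable M (\<lambda>x. \<bar>indicator E x * p x\<bar>)"
      using ip E by (auto intro!: integrable_abs integrable_indicator_mult simp del: integrable_abs_iff)
    show "integrable M (\<lambda>x. indicator E x * B)"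
      using E by (intro integrable_indicator_mult integrable_const)
    show "AE x in M. \<bar>indicator E x * p x\<bar> \<le> indicator E x * B"
      using p by (auto simp: ess_bdd_def indicator_def elim!: eventually_mono)
  qed
  also have "\<dots> = B * measure M E" using E by simp
  finally show ?thesis .
qed

text \<open>Dominated convergence with a constant majorant. Convergence in L1 is the form in which
  \<open>abs_kernel_op_le\<close> can use it.\<close>

lemma (in finite_measure) L1_tendsto_of_ess_bdd:
  assumes p: "\<And>n. ess_bdd M B (p n)" "ess_bdd M C q"
    and lim: "AE x in M. (\<lambda>n. p n x) \<longlonglongrightarrow> q x"
  shows "(\<lambda>n. LINT x|M. \<bar>p n x - q x\<bar>) \<longlonglongrightarrow> 0"
proof -
  have m[measurable]: "\<And>n. p n \<in> borel_measurable M" "q \<in> borel_measurable M"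
    using p by (auto dest: ess_bdd_measurable)
  have "(\<lambda>n. LINT x|M. \<bar>p n x - q x\<bar>) \<longlonglongrightarrow> (LINT x|M. 0)"
  proof (rule integral_dominated_convergence[where w = "\<lambda>_. B + C"])
    show "AE x in M. (\<lambda>n. \<bar>p n x - q x\<bar>) \<longlonglongrightarrow> 0"
      using lim
    proof eventually_elim
      case (elim x)
      from tendsto_diff[OF elim tendsto_const[of "q x"]] show ?case
        by (simp add: tendsto_rabs_zero)
    qed
    show "AE x in M. norm \<bar>p n x - q x\<bar> \<le> B + C" for n
      using ess_bdd_diff[OF p(1)[of n] p(2)] by (simp add: ess_bdd_def)
  qed auto
  then show ?thesis by simp
qed

text \<open>Egorov at a single tolerance \<open>e\<close>: the sets where some later term exceeds
  \<open>e\<close> decrease to a null set, so one of them is small.\<close>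

lemma (in finite_measure) AE_tendsto_0_uniformly:
  fixes f :: "nat \<Rightarrow> 'a \<Rightarrow> real"
  assumes f[measurable]: "\<And>n. f n \<in> borel_measurable M"
    and lim: "AE x in M. (\<lambda>n. f n x) \<longlonglongrightarrow> 0" and e: "0 < e" and d: "0 < d"
  obtains X N where "X \<in> sets M" "measure M X < d"
    "\<And>n x. N \<le> n \<Longrightarrow> x \<in> space M - X \<Longrightarrow> \<bar>f n x\<bar> \<le> e"
proof -
  define X where "X N = {x \<in> space M. \<exists>n\<ge>N. e < \<bar>f n x\<bar>}" for N
  have X: "X N \<in> sets M" for N unfolding X_def by measurable
  have "AE x in M. x \<notin> (\<Inter>N. X N)"
    using lim
  proof eventually_elim
    case (elim x)
    then obtain N where "\<forall>n\<ge>N. \<bar>f n x\<bar> < e"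
      using LIMSEQ_D[OF elim e] by auto
    then have "x \<notin> X N" unfolding X_def using less_asym by blast
    then show ?case by blast
  qed
  then have "measure M (\<Inter>N. X N) = 0"
    using X by (subst measure_eq_0_null_sets) (auto simp: AE_iff_null_sets)
  moreover have "decseq X"
    unfolding decseq_def X_def using le_trans by blast
  ultimately have "(\<lambda>N. measure M (X N)) \<longlonglongrightarrow> 0"
    using finite_Lim_measure_decseq[of X] X by auto
  then have "\<forall>\<^sub>F N in sequentially. measure M (X N) < d" using d by (rule order_tendstoD)
  then obtain N where "measure M (X N) < d" by (auto simp: eventually_sequentially)
  with X show thesis by (rule that[of "X N" N]) (auto simp: X_def not_less)
qed

section \<open>The integral operators of a bounded kernel\<close>

definition kernel_op :: "'a measure \<Rightarrow> ('a \<Rightarrow> 'a \<Rightarrow> real) \<Rightarrow> ('a \<Rightarrow> real) \<Rightarrow> 'a \<Rightarrow> real" where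
  "kernel_op M K p x = (LINT y|M. K x y * p y)"

definition voting_op :: "'a measure \<Rightarrow> ('a \<Rightarrow> 'a \<Rightarrow> real) \<Rightarrow> ('a \<Rightarrow> real) \<Rightarrow> 'a \<Rightarrow> real" where
  "voting_op M K p x = (LINT y|M. K x y * (p y - p x))"

text \<open>Partial sum of the exponential series of \<open>t\<close> times
  \<open>voting_op\<close>, applied to \<open>g\<close>. Here \<open>n\<close> counts terms, so the
  sum is zero for \<open>n = 0\<close> and the remainder estimate starts from the bound of the
  solution itself.\<close>

definition voting_taylor ::
    "'a measure \<Rightarrow> ('a \<Rightarrow> 'a \<Rightarrow> real) \<Rightarrow> ('a \<Rightarrow> real) \<Rightarrow> nat \<Rightarrow> real \<Rightarrow> 'a \<Rightarrow> real" where
  "voting_taylor M K g n t x = (\<Sum>k<n. t ^ k / fact k * (voting_op M K ^^ k) g x)"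

text \<open>Differentiation shifts the coefficients and drops one term, which is what lets an
  induction on the number of terms work. The \<open>a k\<close> will be integrals of the iterates
  over a fixed set.\<close>

lemma has_real_derivative_power_series_partial_sum:
  "((\<lambda>t::real. \<Sum>k<Suc n. t ^ k / fact k * a k) has_real_derivative
     (\<Sum>k<n. t ^ k / fact k * a (Suc k))) (at t)"
proof (induction n)
  case 0
  then show ?case by simp
next
  case (Suc n)
  have "((\<lambda>t::real. t ^ Suc n / fact (Suc n) * a (Suc n)) has_real_derivative
      t ^ n / fact n * a (Suc n)) (at t)"
    using DERIV_cmult[OF DERIV_pow[of "Suc n" t], of "a (Suc n) / fact (Suc n)"]
    by (simp add: field_simps del: power_Suc of_nat_Suc)
  from DERIV_add[OF Suc this] show ?case by simp
qed

text \<open>Joint measurability makes \<open>kernel_op\<close> of a measurable function measurable;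
  the bound is required everywhere so that estimates of \<open>kernel_op\<close> hold at every point
  and not just almost everywhere.\<close>

locale bounded_kernel = prob_space +
  fixes K :: "'a \<Rightarrow> 'a \<Rightarrow> real"
  assumes kernel_measurable: "case_prod K \<in> borel_measurable (M \<Otimes>\<^sub>M M)"
    and kernel_bound: "x \<in> space M \<Longrightarrow> y \<in> space M \<Longrightarrow> \<bar>K x y\<bar> \<le> 1"
begin

lemma kernel_section_measurable: "x \<in> space M \<Longrightarrow> K x \<in> borel_measurable M"
  using measurable_Pair2[OF kernel_measurable] by simp

lemma integrable_kernel_mult:
  assumes p: "integrable M p" and x: "x \<in> space M"
  shows "integrable M (\<lambda>y. K x y * p y)"
proof (rule Bochner_Integration.integrable_bound[OF p])
  show "(\<lambda>y. K x y * p y) \<in> borel_measurable M"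
    using kernel_section_measurable[OF x] p by measurable
  show "AE y in M. norm (K x y * p y) \<le> norm (p y)"
    using kernel_bound[OF x] by (auto simp: abs_mult intro!: AE_I2 mult_left_le_one_le)
qed

text \<open>The smoothing property: the L1 norm controls the value at every point, so L1 convergence
  becomes uniform convergence.\<close>

lemma abs_kernel_op_le:
  assumes p: "integrable M p" and x: "x \<in> space M"
  shows "\<bar>kernel_op M K p x\<bar> \<le> (LINT y|M. \<bar>p y\<bar>)"
proof -
  have "\<bar>kernel_op M K p x\<bar> \<le> (LINT y|M. \<bar>K x y * p y\<bar>)"
    unfolding kernel_op_def by simp
  also have "\<dots> \<le> (LINT y|M. \<bar>p y\<bar>)"
  proof (rule integral_mono)
    show "integrable M (\<lambda>y. \<bar>K x y * p y\<bar>)" "integrable M (\<lambda>y. \<bar>p y\<bar>)"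
      using integrable_kernel_mult[OF p x] p by (auto intro: integrable_abs)
    show "\<bar>K x y * p y\<bar> \<le> \<bar>p y\<bar>" if "y \<in> space M" for y
      using kernel_bound[OF x that] by (simp add: abs_mult mult_left_le_one_le)
  qed
  finally show ?thesis .
qed

lemma kernel_op_measurable:
  assumes [measurable]: "p \<in> borel_measurable M"
  shows "kernel_op M K p \<in> borel_measurable M"
proof -
  note kernel_measurable[measurable]
  have "(\<lambda>(x, y). K x y * p y) \<in> borel_measurable (M \<Otimes>\<^sub>M M)"
  proof -
    have "(\<lambda>z. case_prod K z * p (snd z)) \<in> borel_measurable (M \<Otimes>\<^sub>M M)" by measurable
    then show ?thesis by (simp add: case_prod_beta)
  qed
  then show ?thesis unfolding kernel_op_def by (rule borel_measurable_lebesgue_integral)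
qed

lemma kernel_op_diff:
  assumes "integrable M p" "integrable M q" "x \<in> space M"
  shows "kernel_op M K (\<lambda>y. p y - q y) x = kernel_op M K p x - kernel_op M K q x"
  using integrable_kernel_mult[OF assms(1,3)] integrable_kernel_mult[OF assms(2,3)]
  by (simp add: kernel_op_def right_diff_distrib)

lemma kernel_op_sum:
  assumes p: "\<And>k. k \<in> A \<Longrightarrow> integrable M (p k)" and x: "x \<in> space M"
  shows "kernel_op M K (\<lambda>x. \<Sum>k\<in>A. c k * p k x) x = (\<Sum>k\<in>A. c k * kernel_op M K (p k) x)"
proof -
  have "kernel_op M K (\<lambda>x. \<Sum>k\<in>A. c k * p k x) x = (LINT y|M. (\<Sum>k\<in>A. c k * (K x y * p k y)))"
    unfolding kernel_op_def
    by (intro Bochner_Integration.integral_cong refl) (simp add: sum_distrib_left ac_simps)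
  also have "\<dots> = (\<Sum>k\<in>A. LINT y|M. c k * (K x y * p k y))"
    by (intro Bochner_Integration.integral_sum integrable_mult_right integrable_kernel_mult p x)
  finally show ?thesis by (simp add: kernel_op_def)
qed

lemma ess_bdd_kernel_op:
  assumes p: "ess_bdd M B p"
  shows "ess_bdd M B (kernel_op M K p)"
proof -
  have ip: "integrable M p" and pB: "AE x in M. \<bar>p x\<bar> \<le> B"
    using ess_bdd_integrable[OF p] p by (simp_all add: ess_bdd_def)
  have "(LINT y|M. \<bar>p y\<bar>) \<le> (LINT y|M. B)"
    using ip pB by (intro integral_mono_AE) auto
  then have "(LINT y|M. \<bar>p y\<bar>) \<le> B" by (simp add: prob_space)
  then show ?thesis
    using abs_kernel_op_le[OF ip] kernel_op_measurable[OF ess_bdd_measurable[OF p]]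
    by (auto simp: ess_bdd_def intro!: AE_I2 intro: order_trans)
qed

text \<open>Separates the smoothing part from multiplication by the degree function
  \<open>kernel_op M K (\<lambda>_. 1)\<close>. The integrability of \<open>p\<close> is what
  permits splitting the integral.\<close>

lemma voting_op_eq:
  assumes p: "integrable M p" and x: "x \<in> space M"
  shows "voting_op M K p x = kernel_op M K p x - p x * kernel_op M K (\<lambda>_. 1) x"
  using integrable_kernel_mult[OF p x] integrable_kernel_mult[OF _ x, of "\<lambda>_. 1"]
  by (simp add: voting_op_def kernel_op_def right_diff_distrib mult.commute[of _ "p x"])

lemma ess_bdd_voting_op:
  assumes p: "ess_bdd M B p"
  shows "ess_bdd M (2 * B) (voting_op M K p)"
proof -
  have ip: "integrable M p" and [measurable]: "p \<in> borel_measurable M"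
    using p by (auto intro: ess_bdd_integrable ess_bdd_measurable)
  note [measurable] = kernel_op_measurable
  have "(\<lambda>x. kernel_op M K p x - p x * kernel_op M K (\<lambda>_. 1) x) \<in> borel_measurable M"
    by measurable
  then have "voting_op M K p \<in> borel_measurable M"
    by (subst measurable_cong[where g = "\<lambda>x. kernel_op M K p x - p x * kernel_op M K (\<lambda>_. 1) x"])
      (auto simp: voting_op_eq[OF ip])
  moreover have "AE x in M. \<bar>voting_op M K p x\<bar> \<le> 2 * B"
  proof -
    have pB: "AE x in M. \<bar>p x\<bar> \<le> B" using p by (simp add: ess_bdd_def)
    have TB: "AE x in M. \<bar>kernel_op M K p x\<bar> \<le> B"
      using ess_bdd_kernel_op[OF p] by (simp add: ess_bdd_def)
    from pB AE_space TB show ?thesis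
    proof eventually_elim
      case (elim x)
      have "\<bar>kernel_op M K (\<lambda>_. 1) x\<bar> \<le> 1"
        using abs_kernel_op_le[OF _ elim(2), of "\<lambda>_. 1"] by (simp add: prob_space)
      then have "\<bar>p x * kernel_op M K (\<lambda>_. 1) x\<bar> \<le> B * 1"
        unfolding abs_mult using elim by (intro mult_mono) auto
      with elim(3) show ?case unfolding voting_op_eq[OF ip elim(2)] by linarith
    qed
  qed
  ultimately show ?thesis by (simp add: ess_bdd_def)
qed

lemma ess_bdd_voting_op_funpow:
  "ess_bdd M B p \<Longrightarrow> ess_bdd M (2 ^ k * B) ((voting_op M K ^^ k) p)"
  by (induction k) (auto dest: ess_bdd_voting_op simp: mult.assoc)

lemma voting_op_diff:
  assumes p: "integrable M p" and q: "integrable M q" and x: "x \<in> space M"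
  shows "voting_op M K (\<lambda>x. p x - q x) x = voting_op M K p x - voting_op M K q x"
  using p q x by (simp add: voting_op_eq kernel_op_diff left_diff_distrib)

lemma voting_op_sum:
  assumes p: "\<And>k. k \<in> A \<Longrightarrow> integrable M (p k)" and x: "x \<in> space M"
  shows "voting_op M K (\<lambda>x. \<Sum>k\<in>A. c k * p k x) x = (\<Sum>k\<in>A. c k * voting_op M K (p k) x)"
proof -
  have int: "integrable M (\<lambda>y. K x y * (p k y - p k x))" if "k \<in> A" for k
    using integrable_kernel_mult[OF p[OF that] x] integrable_kernel_mult[OF _ x, of "\<lambda>_. p k x"]
    by (simp add: right_diff_distrib)
  have "voting_op M K (\<lambda>x. \<Sum>k\<in>A. c k * p k x) x
      = (LINT y|M. (\<Sum>k\<in>A. c k * (K x y * (p k y - p k x))))"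
    unfolding voting_op_def
    by (intro Bochner_Integration.integral_cong refl)
      (simp add: sum_subtractf[symmetric] sum_distrib_left algebra_simps)
  also have "\<dots> = (\<Sum>k\<in>A. LINT y|M. c k * (K x y * (p k y - p k x)))"
    by (intro Bochner_Integration.integral_sum integrable_mult_right int)
  finally show ?thesis by (simp add: voting_op_def)
qed

section \<open>Taylor polynomials of the solution and their remainder\<close>

lemma ess_bdd_voting_taylor:
  assumes "ess_bdd M B g"
  shows "\<exists>C. ess_bdd M C (voting_taylor M K g n t)"
proof (induction n)
  case 0
  then show ?case by (auto simp: voting_taylor_def ess_bdd_def intro: exI[of _ 0])
next
  case (Suc n)
  then obtain C where "ess_bdd M C (voting_taylor M K g n t)" by blast
  then have "ess_bdd M (C + \<bar>t ^ n / fact n\<bar> * (2 ^ n * B))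
      (\<lambda>x. voting_taylor M K g n t x + t ^ n / fact n * (voting_op M K ^^ n) g x)"
    by (intro ess_bdd_add ess_bdd_scale ess_bdd_voting_op_funpow assms)
  then show ?case by (auto simp: voting_taylor_def)
qed

lemma set_integral_voting_taylor:
  assumes g: "ess_bdd M B g" and E: "E \<in> sets M"
  shows "(LINT x:E|M. voting_taylor M K g n t x)
    = (\<Sum>k<n. t ^ k / fact k * (LINT x:E|M. (voting_op M K ^^ k) g x))"
proof -
  have int: "integrable M (\<lambda>x. t ^ k / fact k * (indicator E x * (voting_op M K ^^ k) g x))" for k
    by (intro integrable_mult_right integrable_indicator_mult E
        ess_bdd_integrable[OF ess_bdd_voting_op_funpow[OF g]])
  have "(LINT x:E|M. voting_taylor M K g n t x)
      = (LINT x|M. (\<Sum>k<n. t ^ k / fact k * (indicator E x * (voting_op M K ^^ k) g x)))"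
    by (auto simp: set_lebesgue_integral_def voting_taylor_def sum_distrib_left ac_simps
        intro!: Bochner_Integration.integral_cong sum.cong)
  also have "\<dots> = (\<Sum>k<n. LINT x|M. t ^ k / fact k * (indicator E x * (voting_op M K ^^ k) g x))"
    by (intro Bochner_Integration.integral_sum int)
  finally show ?thesis by (simp add: set_lebesgue_integral_def)
qed

lemma voting_op_voting_taylor:
  assumes g: "ess_bdd M B g" and x: "x \<in> space M"
  shows "voting_op M K (voting_taylor M K g n t) x
    = (\<Sum>k<n. t ^ k / fact k * (voting_op M K ^^ Suc k) g x)"
  unfolding voting_taylor_def
  using voting_op_sum[of "{..<n}" "\<lambda>k. (voting_op M K ^^ k) g" x "\<lambda>k. t ^ k / fact k"]
    ess_bdd_integrable[OF ess_bdd_voting_op_funpow[OF g]] x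
  by simp

text \<open>Testing against indicator functions turns the equation into scalar ones, so that the
  mean value theorem for real functions yields bounds in the essential supremum norm.\<close>

lemma voting_taylor_remainder:
  fixes u :: "real \<Rightarrow> 'a \<Rightarrow> real"
  assumes g: "ess_bdd M B\<^sub>0 g"
    and u: "\<And>t. 0 \<le> t \<Longrightarrow> t \<le> T \<Longrightarrow> ess_bdd M B (u t)"
    and init: "AE x in M. u 0 x = g x"
    and cont: "\<And>E. E \<in> sets M \<Longrightarrow> continuous_on {0..T} (\<lambda>t. LINT x:E|M. u t x)"
    and deriv: "\<And>E t. E \<in> sets M \<Longrightarrow> 0 < t \<Longrightarrow> t < T \<Longrightarrow>
      ((\<lambda>s. LINT x:E|M. u s x) has_real_derivative (LINT x:E|M. voting_op M K (u t) x)) (at t)"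
    and t: "0 \<le> t" "t \<le> T"
  shows "ess_bdd M (B * (2 * t) ^ n / fact n) (\<lambda>x. u t x - voting_taylor M K g n t x)"
  using t
proof (induction n arbitrary: t)
  case 0
  then show ?case using u by (simp add: voting_taylor_def)
next
  case (Suc n)
  let ?P = "voting_taylor M K g"
  \<comment> \<open>The value of \<open>C\<close> is immaterial; it serves only to make the
    difference and its parts integrable.\<close>
  obtain C where C: "ess_bdd M C (?P (Suc n) t)" using ess_bdd_voting_taylor[OF g] by blast
  have diff: "ess_bdd M (B + C) (\<lambda>x. u t x - ?P (Suc n) t x)"
    using ess_bdd_diff[OF u[OF Suc.prems] C] .
  have set_int: "set_integrable M E p" if "ess_bdd M D p" "E \<in> sets M" for D E and p :: "'a \<Rightarrow> real"
    using ess_bdd_integrable[OF that(1)] that(2) unfolding set_integrable_def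
    by (auto intro!: integrable_indicator_mult)
  have "\<bar>LINT x:E|M. u t x - ?P (Suc n) t x\<bar> \<le> B * (2 * t) ^ Suc n / fact (Suc n) * measure M E"
    if E: "E \<in> sets M" for E
  proof -
    define f where "f s = (LINT x:E|M. u s x) - (LINT x:E|M. ?P (Suc n) s x)" for s
    define a where "a k = (LINT x:E|M. (voting_op M K ^^ k) g x)" for k
    define b where "b s = B * (2 * s) ^ Suc n / fact (Suc n) * measure M E" for s
    \<comment> \<open>Twice the bound of the induction hypothesis, with 2 from
      \<open>ess_bdd_voting_op\<close>. It is exactly the derivative of \<open>b\<close>, which
      explains the factor \<open>(2 * t) ^ n / fact n\<close> in the claim.\<close>
    define b' where "b' s = 2 * (B * (2 * s) ^ n / fact n) * measure M E" for s
    have P: "(LINT x:E|M. ?P m s x) = (\<Sum>k<m. s ^ k / fact k * a k)" for m s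
      unfolding a_def by (rule set_integral_voting_taylor[OF g E])
    have f0: "f 0 = 0"
    proof -
      have "(LINT x:E|M. u 0 x) = (LINT x:E|M. g x)"
      proof -
        have "AE x in M. indicator E x *\<^sub>R u 0 x = indicator E x *\<^sub>R g x"
          using init by eventually_elim simp
        moreover have "u 0 \<in> borel_measurable M" "g \<in> borel_measurable M"
          using u[of 0] g Suc.prems by (auto dest: ess_bdd_measurable)
        ultimately show ?thesis
          unfolding set_lebesgue_integral_def using E by (intro integral_cong_AE) auto
      qed
      \<comment> \<open>Since \<open>0 ^ 0 = 1\<close>, only the constant term survives at time
        0.\<close>
      moreover have "(\<Sum>k<Suc n. 0 ^ k / fact k * a k) = a 0"
        by (simp add: sum.lessThan_Suc_shift del: sum.lessThan_Suc)
      ultimately show ?thesis by (simp add: f_def P a_def)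
    qed
    have df: "\<exists>d. (f has_real_derivative d) (at s) \<and> \<bar>d\<bar> \<le> b' s" if s: "0 < s" "s < T" for s
    proof (intro exI conjI)
      \<comment> \<open>The derivative of the polynomial with \<open>Suc n\<close> terms is
        \<open>voting_op\<close> of the one with \<open>n\<close> terms. Hence \<open>?d\<close> is
        the integral of \<open>voting_op\<close> applied to the previous remainder, to which the
        induction hypothesis applies.\<close>
      let ?d = "(LINT x:E|M. voting_op M K (u s) x) - (\<Sum>k<n. s ^ k / fact k * a (Suc k))"
      show "(f has_real_derivative ?d) (at s)"
        unfolding f_def P
        by (intro DERIV_diff deriv[OF E s] has_real_derivative_power_series_partial_sum)
      obtain D where D: "ess_bdd M D (?P n s)" using ess_bdd_voting_taylor[OF g] by blast
      have us: "ess_bdd M B (u s)" using u s by simp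
      have iu: "integrable M (u s)" and iP: "integrable M (?P n s)"
        using us D by (auto intro: ess_bdd_integrable)
      have "(\<Sum>k<n. s ^ k / fact k * a (Suc k)) = (LINT x:E|M. voting_op M K (?P n s) x)"
      proof -
        have "(LINT x:E|M. voting_op M K (?P n s) x)
            = (LINT x:E|M. voting_taylor M K (voting_op M K g) n s x)"
          using sets.sets_into_space[OF E]
          by (intro set_lebesgue_integral_cong E)
            (auto simp: voting_op_voting_taylor[OF g] voting_taylor_def[of _ _ "voting_op M K g"]
              funpow_Suc_right simp del: funpow.simps)
        then show ?thesis
          by (simp add: set_integral_voting_taylor[OF ess_bdd_voting_op[OF g] E] a_def
              funpow_Suc_right del: funpow.simps)
      qed
      then have "?d = (LINT x:E|M. voting_op M K (u s) x - voting_op M K (?P n s) x)"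
        using set_int[OF ess_bdd_voting_op[OF us] E] set_int[OF ess_bdd_voting_op[OF D] E] by simp
      also have "\<dots> = (LINT x:E|M. voting_op M K (\<lambda>x. u s x - ?P n s x) x)"
        using sets.sets_into_space[OF E]
        by (intro set_lebesgue_integral_cong E) (auto simp: voting_op_diff[OF iu iP])
      finally have "?d = (LINT x:E|M. voting_op M K (\<lambda>x. u s x - ?P n s x) x)" .
      moreover have "ess_bdd M (B * (2 * s) ^ n / fact n) (\<lambda>x. u s x - ?P n s x)"
        using Suc.IH s by simp
      ultimately show "\<bar>?d\<bar> \<le> b' s"
        unfolding b'_def by (simp only: abs_set_integral_le_ess_bdd[OF ess_bdd_voting_op E])
    qed
    have db: "(b has_real_derivative b' s) (at s)" for s
    proof -
      have b: "b = (\<lambda>s. B * 2 ^ Suc n / fact (Suc n) * measure M E * s ^ Suc n)"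
        by (simp add: b_def fun_eq_iff power_mult_distrib del: power_Suc fact_Suc)
      have b': "b' s = B * 2 ^ Suc n / fact (Suc n) * measure M E * (real (Suc n) * s ^ (Suc n - Suc 0))"
        by (simp add: b'_def power_mult_distrib del: of_nat_Suc)
      show ?thesis unfolding b b' by (rule DERIV_cmult[OF DERIV_pow])
    qed
    have contf: "continuous_on {0..t} f"
      unfolding f_def P
      by (intro continuous_intros continuous_on_subset[OF cont[OF E]]) (use Suc.prems in auto)
    have contb: "continuous_on {0..t} b"
      unfolding b_def by (intro continuous_intros) auto
    \<comment> \<open>Both signs of \<open>f\<close> are compared with \<open>b\<close> at once. The
      derivative is available only at interior times, so the monotonicity criterion for the open
      interval is used, with continuity at the ends.\<close>
    have mono: "h t \<le> b t" if h: "h = f \<or> h = (\<lambda>s. - f s)" for h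
    proof -
      have "h t - b t \<le> h 0 - b 0"
      proof (rule DERIV_nonpos_imp_decreasing_open[of 0 t "\<lambda>s. h s - b s"])
        show "0 \<le> t" by fact
        show "continuous_on {0..t} (\<lambda>s. h s - b s)"
          using h contf contb by (auto intro!: continuous_intros)
        fix s assume s: "0 < s" "s < t"
        then obtain d where d: "(f has_real_derivative d) (at s)" "\<bar>d\<bar> \<le> b' s"
          using df[of s] Suc.prems by auto
        show "\<exists>y. ((\<lambda>s. h s - b s) has_real_derivative y) (at s) \<and> y \<le> 0"
          using h
        proof
          assume "h = f"
          then show ?thesis using d db[of s]
            by (intro exI[of _ "d - b' s"]) (auto intro!: derivative_intros)
        next
          assume "h = (\<lambda>s. - f s)"
          then show ?thesis using d db[of s]
            by (intro exI[of _ "- d - b' s"]) (auto intro!: derivative_intros)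
        qed
      qed
      then show ?thesis using h f0 by (auto simp: b_def)
    qed
    have "\<bar>f t\<bar> \<le> b t" using mono[of f] mono[of "\<lambda>s. - f s"] by auto
    then show ?thesis
      unfolding f_def b_def
      using set_int[OF u[OF Suc.prems] E] set_int[OF C E] by simp
  qed
  then have "AE x in M. \<bar>u t x - ?P (Suc n) t x\<bar> \<le> B * (2 * t) ^ Suc n / fact (Suc n)"
    by (rule AE_abs_le_of_set_integrals[OF ess_bdd_integrable[OF diff]])
  with ess_bdd_measurable[OF diff] show ?case
    unfolding ess_bdd_def by (rule conjI)
qed

lemma abs_voting_taylor_le:
  assumes "\<And>k. \<bar>(voting_op M K ^^ k) g x\<bar> \<le> 2 ^ k * B" and "0 \<le> t" and "n \<le> m"
  shows "\<bar>voting_taylor M K g m t x - voting_taylor M K g n t x\<bar>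
    \<le> B * (\<Sum>k\<in>{n..<m}. (2 * t) ^ k / fact k)"
proof -
  have "voting_taylor M K g m t x - voting_taylor M K g n t x
      = (\<Sum>k\<in>{n..<m}. t ^ k / fact k * (voting_op M K ^^ k) g x)"
    unfolding voting_taylor_def using \<open>n \<le> m\<close>
    by (simp add: sum_diff_nat_ivl[of 0 n m, unfolded atLeast0LessThan])
  also have "\<bar>\<dots>\<bar> \<le> (\<Sum>k\<in>{n..<m}. \<bar>t ^ k / fact k * (voting_op M K ^^ k) g x\<bar>)"
    by (rule sum_abs)
  also have "\<dots> \<le> (\<Sum>k\<in>{n..<m}. B * ((2 * t) ^ k / fact k))"
  proof (rule sum_mono)
    fix k
    have "\<bar>t ^ k / fact k * (voting_op M K ^^ k) g x\<bar> \<le> t ^ k / fact k * (2 ^ k * B)"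
      unfolding abs_mult using assms(1)[of k] assms(2) by (intro mult_mono) auto
    then show "\<bar>t ^ k / fact k * (voting_op M K ^^ k) g x\<bar> \<le> B * ((2 * t) ^ k / fact k)"
      by (simp add: power_mult_distrib mult.commute mult.left_commute)
  qed
  finally show ?thesis by (simp only: sum_distrib_left)
qed

text \<open>The remainder estimate involves \<open>B\<close>, the bound of the solution. Comparing
  \<open>n\<close> terms with \<open>m\<close> terms and letting \<open>m\<close> tend to infinity
  at a fixed \<open>x\<close> removes it: the remainder after \<open>m\<close> terms vanishes, and
  the remaining terms are bounded by an exponential tail with the factor \<open>B\<^sub>0\<close> of
  the initial condition.\<close>

lemma voting_taylor_approx:
  fixes u :: "real \<Rightarrow> 'a \<Rightarrow> real"
  assumes g: "ess_bdd M B\<^sub>0 g"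
    and u: "\<And>t. 0 \<le> t \<Longrightarrow> t \<le> T \<Longrightarrow> ess_bdd M B (u t)"
    and init: "AE x in M. u 0 x = g x"
    and cont: "\<And>E. E \<in> sets M \<Longrightarrow> continuous_on {0..T} (\<lambda>t. LINT x:E|M. u t x)"
    and deriv: "\<And>E t. E \<in> sets M \<Longrightarrow> 0 < t \<Longrightarrow> t < T \<Longrightarrow>
      ((\<lambda>s. LINT x:E|M. u s x) has_real_derivative (LINT x:E|M. voting_op M K (u t) x)) (at t)"
    and t: "0 \<le> t" "t \<le> T"
  shows "AE x in M. \<bar>u t x - voting_taylor M K g n t x\<bar>
    \<le> B\<^sub>0 * (exp (2 * T) - (\<Sum>k<n. (2 * T) ^ k / fact k))"
proof -
  have exp_sums: "(\<lambda>k. x ^ k / fact k) sums exp x" for x :: real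
    using exp_converges[of x] by (simp add: divide_inverse mult.commute)
  have "ess_bdd M (B * (2 * t) ^ m / fact m) (\<lambda>x. u t x - voting_taylor M K g m t x)" for m
    by (rule voting_taylor_remainder[where T = T and u = u and B = B]) (fact assms)+
  \<comment> \<open>All orders at once, a countable union of null sets, so that the limit in
    \<open>m\<close> can be taken pointwise.\<close>
  then have "AE x in M. \<forall>m. \<bar>u t x - voting_taylor M K g m t x\<bar> \<le> B * (2 * t) ^ m / fact m"
    by (auto simp: AE_all_countable ess_bdd_def)
  moreover have "AE x in M. \<forall>k. \<bar>(voting_op M K ^^ k) g x\<bar> \<le> 2 ^ k * B\<^sub>0"
    using ess_bdd_voting_op_funpow[OF g] by (auto simp: AE_all_countable ess_bdd_def)
  ultimately show ?thesis
  proof eventually_elim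
    case (elim x)
    have B0: "0 \<le> B\<^sub>0" using ess_bdd_nonneg[OF g] .
    let ?tail = "\<lambda>m. \<Sum>k\<in>{n..<m}. (2 * T) ^ k / fact k"
    have "\<bar>u t x - voting_taylor M K g n t x\<bar>
        \<le> B * (2 * t) ^ m / fact m + B\<^sub>0 * ?tail m" if "n \<le> m" for m
    proof -
      \<comment> \<open>Replacing \<open>t\<close> by \<open>T\<close> makes the final bound uniform
        over the time interval.\<close>
      have "(\<Sum>k\<in>{n..<m}. (2 * t) ^ k / fact k) \<le> ?tail m"
        using t by (intro sum_mono divide_right_mono power_mono) auto
      then have "B\<^sub>0 * (\<Sum>k\<in>{n..<m}. (2 * t) ^ k / fact k) \<le> B\<^sub>0 * ?tail m"
        using B0 by (rule mult_left_mono)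
      moreover have "\<bar>voting_taylor M K g m t x - voting_taylor M K g n t x\<bar>
          \<le> B\<^sub>0 * (\<Sum>k\<in>{n..<m}. (2 * t) ^ k / fact k)"
        using elim(2) t that by (intro abs_voting_taylor_le) auto
      ultimately show ?thesis using elim(1)[rule_format, of m] by linarith
    qed
    moreover have "(\<lambda>m. B * (2 * t) ^ m / fact m + B\<^sub>0 * ?tail m)
        \<longlonglongrightarrow> B * 0 + B\<^sub>0 * (exp (2 * T) - (\<Sum>k<n. (2 * T) ^ k / fact k))"
    proof (intro tendsto_add tendsto_mult_left)
      show "(\<lambda>m. B * (2 * t) ^ m / fact m) \<longlonglongrightarrow> B * 0"
        using tendsto_mult_left[OF summable_LIMSEQ_zero[OF sums_summable[OF exp_sums[of "2 * t"]]], of B]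
        by simp
      have "(\<lambda>m. (\<Sum>k<m. (2 * T) ^ k / fact k) - (\<Sum>k<n. (2 * T) ^ k / fact k))
          \<longlonglongrightarrow> exp (2 * T) - (\<Sum>k<n. (2 * T) ^ k / fact k)"
        using exp_sums[of "2 * T"] by (intro tendsto_intros) (simp add: sums_def)
      moreover have "\<forall>\<^sub>F m in sequentially. (\<Sum>k<m. (2 * T) ^ k / fact k)
          - (\<Sum>k<n. (2 * T) ^ k / fact k) = ?tail m"
        using eventually_ge_at_top[of n]
        by eventually_elim (simp add: sum_diff_nat_ivl[of 0 n, unfolded atLeast0LessThan])
      ultimately show "?tail \<longlonglongrightarrow> exp (2 * T) - (\<Sum>k<n. (2 * T) ^ k / fact k)"
        by (rule Lim_transform_eventually)
    qed
    ultimately have "\<bar>u t x - voting_taylor M K g n t x\<bar>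
        \<le> B * 0 + B\<^sub>0 * (exp (2 * T) - (\<Sum>k<n. (2 * T) ^ k / fact k))"
      by (intro LIMSEQ_le_const[where X = "\<lambda>m. B * (2 * t) ^ m / fact m + B\<^sub>0 * ?tail m"]) blast+
    then show ?case by simp
  qed
qed

end

subsection \<open>Solutions on the unit interval\<close>

abbreviation unit_leb :: "real measure" where
  "unit_leb \<equiv> lebesgue_on {0..1}"

lemma prob_space_unit_leb: "prob_space unit_leb"
  by (intro prob_spaceI) (simp add: emeasure_restrict_space)

interpretation unit_leb: prob_space unit_leb
  by (rule prob_space_unit_leb)

lemma AE_lebesgue_on_iff:
  "S \<in> sets lebesgue \<Longrightarrow> (AE x in lebesgue_on S. P x) \<longleftrightarrow> (AE x in lebesgue. x \<in> S \<longrightarrow> P x)"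
  by (rule AE_restrict_space_iff) simp

text \<open>By completeness of Lebesgue measure, after extension by zero outside
  \<open>S\<close>.\<close>

lemma borel_measurable_lebesgue_on_AE:
  fixes f g :: "'a::euclidean_space \<Rightarrow> real"
  assumes f: "f \<in> borel_measurable (lebesgue_on S)" and S: "S \<in> sets lebesgue"
    and eq: "AE x in lebesgue_on S. f x = g x"
  shows "g \<in> borel_measurable (lebesgue_on S)"
proof (rule borel_measurable_if_D)
  have "(\<lambda>x. if x \<in> S then f x else 0) \<in> borel_measurable lebesgue"
    using f S by (simp add: borel_measurable_if)
  moreover have "AE x in lebesgue. (if x \<in> S then f x else 0) = (if x \<in> S then g x else 0)"
    using eq unfolding AE_lebesgue_on_iff[OF S] by eventually_elim simp
  ultimately show "(\<lambda>x. if x \<in> S then g x else 0) \<in> borel_measurable lebesgue"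
    by (rule borel_measurable_AE)
qed

lemma ess_bdd_Linf_norm:
  assumes f: "f \<in> borel_measurable unit_leb" and le: "Linf_norm f \<le> ereal c"
  shows "ess_bdd unit_leb c f"
proof -
  have "AE x in unit_leb. ereal \<bar>f x\<bar> \<le> Linf_norm f"
    unfolding Linf_norm_def by (rule esssup_AE)
  then have "AE x in unit_leb. \<bar>f x\<bar> \<le> c"
    by eventually_elim (metis le order_trans ereal_less_eq(3))
  with f show ?thesis by (simp add: ess_bdd_def)
qed

lemma Linf_ess_bdd:
  assumes "f \<in> Linf"
  obtains B where "ess_bdd unit_leb B f"
proof -
  have f: "f \<in> borel_measurable unit_leb" "Linf_norm f < \<infinity>" using assms by (auto simp: Linf_def)
  then obtain B where "Linf_norm f \<le> ereal B"
    by (cases "Linf_norm f") auto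
  with f(1) that show ?thesis by (blast intro: ess_bdd_Linf_norm)
qed

lemma Linf_integrable: "f \<in> Linf \<Longrightarrow> integrable unit_leb f"
  by (erule Linf_ess_bdd) (rule unit_leb.ess_bdd_integrable)

section \<open>Continuously differentiable curves of essentially bounded functions\<close>

lemma C1_Linf_difference_quotient:
  assumes "C1_Linf u v" and "0 < e"
  shows "\<forall>\<^sub>F h in at 0. ess_bdd unit_leb e (\<lambda>x. (u x (t + h) - u x t) / h - v x t)"
proof -
  have L: "(\<lambda>x. u x s) \<in> Linf" "(\<lambda>x. v x s) \<in> Linf" for s using assms by (auto simp: C1_Linf_def)
  have m: "(\<lambda>x. u x s) \<in> borel_measurable unit_leb" "(\<lambda>x. v x s) \<in> borel_measurable unit_leb" for s
    using L by (auto simp: Linf_def)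
  have "((\<lambda>h. Linf_norm (\<lambda>x. (u x (t + h) - u x t) / h - v x t)) \<longlongrightarrow> 0) (at 0)"
    using assms by (simp add: C1_Linf_def)
  then have "\<forall>\<^sub>F h in at 0. Linf_norm (\<lambda>x. (u x (t + h) - u x t) / h - v x t) < ereal e"
    by (rule order_tendstoD) (use \<open>0 < e\<close> in simp)
  then show ?thesis
    by eventually_elim (intro ess_bdd_Linf_norm borel_measurable_diff borel_measurable_divide
        borel_measurable_const m less_imp_le)
qed

text \<open>Integration over \<open>E\<close> is a linear functional of norm at most 1 for the
  essential supremum, because the total mass is 1. It therefore carries the derivative of the curve
  to a derivative of real functions.\<close>

lemma C1_Linf_set_integral_has_derivative:
  assumes C1: "C1_Linf u v" and E: "E \<in> sets unit_leb"
  shows "((\<lambda>s. LINT x:E|unit_leb. u x s) has_real_derivative (LINT x:E|unit_leb. v x t)) (at t)"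
  unfolding DERIV_def
proof (rule tendstoI)
  fix e :: real
  assume e: "0 < e"
  have set_int: "set_integrable unit_leb E (\<lambda>x. u x s)" "set_integrable unit_leb E (\<lambda>x. v x s)" for s
    using C1 E
    by (auto simp: C1_Linf_def set_integrable_def intro!: integrable_indicator_mult[OF Linf_integrable])
  have "\<forall>\<^sub>F h in at 0. ess_bdd unit_leb (e / 2) (\<lambda>x. (u x (t + h) - u x t) / h - v x t)"
    using e by (intro C1_Linf_difference_quotient[OF C1]) simp
  then show "\<forall>\<^sub>F h in at 0. dist (((LINT x:E|unit_leb. u x (t + h)) - (LINT x:E|unit_leb. u x t)) / h)
      (LINT x:E|unit_leb. v x t) < e"
  proof eventually_elim
    case (elim h)
    have "((LINT x:E|unit_leb. u x (t + h)) - (LINT x:E|unit_leb. u x t)) / h - (LINT x:E|unit_leb. v x t)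
        = (LINT x:E|unit_leb. (u x (t + h) - u x t) / h - v x t)"
      using set_int by simp
    moreover have "\<bar>LINT x:E|unit_leb. (u x (t + h) - u x t) / h - v x t\<bar> \<le> e / 2 * measure unit_leb E"
      by (rule unit_leb.abs_set_integral_le_ess_bdd[OF elim E])
    moreover have "e / 2 * measure unit_leb E \<le> e / 2 * 1"
      using e unit_leb.prob_le_1 by (intro mult_left_mono) auto
    ultimately show ?case using e unfolding dist_real_def by linarith
  qed
qed

text \<open>Compactness by bisection: boundedness passes to a union of adjacent intervals, and near
  each time it follows from differentiability.\<close>

lemma C1_Linf_bounded_on_interval:
  assumes C1: "C1_Linf u v" and "a \<le> b"
  shows "\<exists>B. \<forall>t\<in>{a..b}. ess_bdd unit_leb B (\<lambda>x. u x t)"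
  using \<open>a \<le> b\<close>
proof (induction rule: Bolzano)
  case (trans a b c)
  then obtain B C where "\<forall>t\<in>{a..b}. ess_bdd unit_leb B (\<lambda>x. u x t)"
    "\<forall>t\<in>{b..c}. ess_bdd unit_leb C (\<lambda>x. u x t)" by blast
  then have "ess_bdd unit_leb (max B C) (\<lambda>x. u x t)" if "t \<in> {a..c}" for t
    using that ess_bdd_mono[of unit_leb B _ "max B C"] ess_bdd_mono[of unit_leb C _ "max B C"]
    by (cases "t \<le> b") auto
  then show ?case by blast
next
  case (local t)
  have L: "(\<lambda>x. u x s) \<in> Linf" "(\<lambda>x. v x s) \<in> Linf" for s using C1 by (auto simp: C1_Linf_def)
  obtain B where B: "ess_bdd unit_leb B (\<lambda>x. u x t)" using Linf_ess_bdd[OF L(1)] .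
  obtain C where C: "ess_bdd unit_leb C (\<lambda>x. v x t)" using Linf_ess_bdd[OF L(2)] .
  from C1_Linf_difference_quotient[OF C1, of 1 t]
  obtain d where d: "0 < d"
    "\<And>h. h \<noteq> 0 \<Longrightarrow> \<bar>h\<bar> < d \<Longrightarrow> ess_bdd unit_leb 1 (\<lambda>x. (u x (t + h) - u x t) / h - v x t)"
    unfolding eventually_at by (auto simp: dist_real_def)
  \<comment> \<open>From \<open>u(s) = u(t) + (s - t) * (?q + v(t))\<close>, where the error
    \<open>?q\<close> of the difference quotient is bounded by 1 and \<open>v(t)\<close> by
    \<open>C\<close>.\<close>
  have bound: "ess_bdd unit_leb (B + d * (C + 1)) (\<lambda>x. u x s)" if s: "\<bar>s - t\<bar> < d" for s
  proof (cases "s = t")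
    case True
    have "0 \<le> C" using C by (rule unit_leb.ess_bdd_nonneg)
    then show ?thesis using d B True by (auto intro: ess_bdd_mono)
  next
    case False
    let ?q = "\<lambda>x. (u x s - u x t) / (s - t) - v x t"
    have "ess_bdd unit_leb 1 ?q" using d(2)[of "s - t"] s False by simp
    then have "ess_bdd unit_leb (B + \<bar>s - t\<bar> * (1 + C)) (\<lambda>x. u x t + (s - t) * (?q x + v x t))"
      by (intro ess_bdd_add ess_bdd_scale B C)
    moreover have "u x t + (s - t) * (?q x + v x t) = u x s" for x using False by simp
    moreover have "\<bar>s - t\<bar> * (1 + C) \<le> d * (C + 1)"
      using s unit_leb.ess_bdd_nonneg[OF C] by (intro mult_mono) auto
    ultimately show ?thesis by (auto elim: ess_bdd_mono)
  qed
  show ?case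
  proof (intro exI conjI allI impI)
    show "0 < d" by fact
    fix a b assume "a \<le> t \<and> t \<le> b \<and> b - a < d"
    then show "\<forall>s\<in>{a..b}. ess_bdd unit_leb (B + d * (C + 1)) (\<lambda>x. u x s)"
      by (auto intro!: bound)
  qed
qed

text \<open>The bound depends on the problem only through \<open>B\<close>, \<open>T\<close> and
  \<open>n\<close>. As averaging does not increase \<open>B\<close>, one truncation order serves the
  limit problem and all approximate ones.\<close>

lemma voting_solution_taylor:
  assumes K: "bounded_kernel unit_leb K"
    and sol: "voting_solution K g u"
    and g: "ess_bdd unit_leb B g"
    and t: "0 \<le> t" "t \<le> T"
  shows "AE x in unit_leb. \<bar>u x t - voting_taylor unit_leb K g n t x\<bar>
    \<le> B * (exp (2 * T) - (\<Sum>k<n. (2 * T) ^ k / fact k))"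
proof -
  interpret K: bounded_kernel unit_leb K by fact
  from sol obtain v where C1: "C1_Linf u v"
    and v: "\<And>t. 0 < t \<Longrightarrow> AE x in unit_leb. v x t = voting_op unit_leb K (\<lambda>x. u x t) x"
    and init: "AE x in unit_leb. u x 0 = g x"
    unfolding voting_solution_def voting_op_def by blast
  obtain C where C: "\<forall>t\<in>{0..T}. ess_bdd unit_leb C (\<lambda>x. u x t)"
    using C1_Linf_bounded_on_interval[OF C1, of 0 T] t by auto
  show ?thesis
  proof (rule K.voting_taylor_approx[where u = "\<lambda>t x. u x t" and T = T and B = C])
    show "ess_bdd unit_leb B g" "AE x in unit_leb. u x 0 = g x" "0 \<le> t" "t \<le> T" by fact+
    show "ess_bdd unit_leb C (\<lambda>x. u x s)" if "0 \<le> s" "s \<le> T" for s using C that by simp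
    fix E assume E: "E \<in> sets unit_leb"
    show "continuous_on {0..T} (\<lambda>t. LINT x:E|unit_leb. u x t)"
      using C1_Linf_set_integral_has_derivative[OF C1 E]
      by (intro continuous_at_imp_continuous_on ballI DERIV_isCont)
    fix s :: real assume s: "0 < s" "s < T"
    have "(LINT x:E|unit_leb. v x s) = (LINT x:E|unit_leb. voting_op unit_leb K (\<lambda>x. u x s) x)"
      unfolding set_lebesgue_integral_def
    proof (rule integral_cong_AE)
      have "(\<lambda>x. v x s) \<in> borel_measurable unit_leb" using C1 by (simp add: C1_Linf_def Linf_def)
      then show "(\<lambda>x. indicator E x *\<^sub>R v x s) \<in> borel_measurable unit_leb" using E by measurable
      have "voting_op unit_leb K (\<lambda>x. u x s) \<in> borel_measurable unit_leb"
        using C s by (intro ess_bdd_measurable[OF K.ess_bdd_voting_op]) auto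
      then show "(\<lambda>x. indicator E x *\<^sub>R voting_op unit_leb K (\<lambda>x. u x s) x) \<in> borel_measurable unit_leb"
        using E by measurable
      show "AE x in unit_leb. indicator E x *\<^sub>R v x s = indicator E x *\<^sub>R voting_op unit_leb K (\<lambda>x. u x s) x"
        using v[OF s(1)] by eventually_elim simp
    qed
    then show "((\<lambda>t. LINT x:E|unit_leb. u x t) has_real_derivative
        (LINT x:E|unit_leb. voting_op unit_leb K (\<lambda>x. u x s) x)) (at s)"
      using C1_Linf_set_integral_has_derivative[OF C1 E] by metis
  qed
qed

text \<open>For almost every \<open>x\<close> the sections \<open>W x\<close> and \<open>K x\<close>
  agree almost everywhere, so the right-hand sides coincide and the same derivative curve
  \<open>v\<close> serves. Measurability of such sections \<open>W x\<close> is inherited from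
  \<open>K x\<close>.\<close>

lemma voting_solution_kernel_cong:
  assumes K: "bounded_kernel unit_leb K"
    and eq: "AE x in unit_leb. AE y in unit_leb. W x y = K x y"
    and sol: "voting_solution W g u"
  shows "voting_solution K g u"
proof -
  interpret K: bounded_kernel unit_leb K by fact
  from sol obtain v where C1: "C1_Linf u v"
    and v: "\<And>t. 0 < t \<Longrightarrow> AE x in unit_leb. v x t = (LINT y|unit_leb. W x y * (u y t - u x t))"
    and init: "AE x in unit_leb. u x 0 = g x"
    unfolding voting_solution_def by blast
  have "AE x in unit_leb. v x t = (LINT y|unit_leb. K x y * (u y t - u x t))" if "0 < t" for t
    using eq v[OF that] AE_space
  proof eventually_elim
    case (elim x)
    have [measurable]: "(\<lambda>y. u y t) \<in> borel_measurable unit_leb"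
      using C1 by (simp add: C1_Linf_def Linf_def)
    have [measurable]: "K x \<in> borel_measurable unit_leb"
      using elim(3) by (rule K.kernel_section_measurable)
    have "AE y in unit_leb. K x y = W x y" using elim(1) by eventually_elim simp
    then have [measurable]: "W x \<in> borel_measurable unit_leb"
      using borel_measurable_lebesgue_on_AE[of "K x" "{0..1}" "W x"] by simp
    have "(LINT y|unit_leb. W x y * (u y t - u x t)) = (LINT y|unit_leb. K x y * (u y t - u x t))"
      using elim(1) by (intro integral_cong_AE) auto
    with elim(2) show ?case by simp
  qed
  with C1 init show ?thesis unfolding voting_solution_def by blast
qed

subsection \<open>Averages over the cells\<close>

text \<open>The Lebesgue differentiation theorem for intervals containing \<open>x\<close> anywhere,
  as the position of a point in its cell is arbitrary. An interval is cut at \<open>x\<close>; the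
  left half is treated as a right half of the reflected function. The error is stated without
  dividing by the length, so that the two halves simply add up.\<close>

lemma interval_averages_tendsto:
  fixes f :: "real \<Rightarrow> real"
  assumes f: "\<And>a b. f integrable_on {a..b}"
  obtains N where "negligible N"
    "\<And>x e. x \<notin> N \<Longrightarrow> 0 < e \<Longrightarrow> \<exists>d>0. \<forall>a b. a \<le> x \<and> x \<le> b \<and> b - a < d \<longrightarrow>
       \<bar>integral {a..b} f - (b - a) * f x\<bar> \<le> e * (b - a)"
proof -
  have right: "\<exists>N. negligible N \<and> (\<forall>x e. x \<notin> N \<and> 0 < e \<longrightarrow>
      (\<exists>d>0. \<forall>h. 0 \<le> h \<and> h < d \<longrightarrow> \<bar>integral {x..x + h} g - h * g x\<bar> \<le> e * h))"
    if g: "\<And>a b. g integrable_on {a..b}" for g :: "real \<Rightarrow> real"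
  proof -
    obtain N where N: "negligible N" "\<And>x e. x \<notin> N \<Longrightarrow> 0 < e \<Longrightarrow>
        \<exists>d>0. \<forall>h. 0 < h \<and> h < d \<longrightarrow> norm (integral (cbox x (x + h *\<^sub>R One)) g /\<^sub>R h ^ DIM(real) - g x) < e"
      using integrable_ccontinuous_explicit[of g] g by auto
    have "\<bar>integral {x..x + h} g - h * g x\<bar> \<le> e * h"
      if "norm (integral (cbox x (x + h *\<^sub>R One)) g /\<^sub>R h ^ DIM(real) - g x) < e" "0 < h" for x e h
    proof -
      have "\<bar>integral {x..x + h} g / h - g x\<bar> < e" using that by (simp add: divide_inverse mult.commute)
      then have "\<bar>h * (integral {x..x + h} g / h - g x)\<bar> \<le> e * h"
        using \<open>0 < h\<close> by (simp add: abs_mult mult.commute)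
      then show ?thesis using \<open>0 < h\<close> by (simp add: right_diff_distrib)
    qed
    \<comment> \<open>The case \<open>h = 0\<close>, where both sides vanish, is included because
      \<open>x\<close> may be an endpoint of the interval.\<close>
    then have "\<exists>d>0. \<forall>h. 0 \<le> h \<and> h < d \<longrightarrow> \<bar>integral {x..x + h} g - h * g x\<bar> \<le> e * h"
      if "x \<notin> N" "0 < e" for x e
      using N(2)[OF that] by (metis abs_zero add_0_right diff_zero integral_refl interval_cbox
          less_eq_real_def mult_zero_left mult_zero_right)
    with N(1) show ?thesis by blast
  qed
  from right[OF f] obtain N1 where N1: "negligible N1" "\<And>x e. x \<notin> N1 \<Longrightarrow> 0 < e \<Longrightarrow>
      \<exists>d>0. \<forall>h. 0 \<le> h \<and> h < d \<longrightarrow> \<bar>integral {x..x + h} f - h * f x\<bar> \<le> e * h"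
    by blast
  have "(\<lambda>x. f (- x)) integrable_on {a..b}" for a b
    using f[of "- b" "- a"]
      Henstock_Kurzweil_Integration.integrable_reflect_real[where f = f and a = "- b" and b = "- a"]
    by simp
  from right[OF this] obtain N2 where N2: "negligible N2" "\<And>x e. x \<notin> N2 \<Longrightarrow> 0 < e \<Longrightarrow>
      \<exists>d>0. \<forall>h. 0 \<le> h \<and> h < d \<longrightarrow> \<bar>integral {x..x + h} (\<lambda>x. f (- x)) - h * f (- x)\<bar> \<le> e * h"
    by blast
  show thesis
  proof (rule that)
    have "negligible (uminus ` N2)"
      by (rule negligible_differentiable_image_negligible[OF _ N2(1)])
        (auto intro!: derivative_intros)
    with N1(1) show "negligible (N1 \<union> uminus ` N2)" by simp
    fix x e :: real
    assume x: "x \<notin> N1 \<union> uminus ` N2" and e: "0 < e"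
    have "- x \<notin> N2" using x by (metis UnI2 add.inverse_inverse image_eqI)
    from N2(2)[OF this e] obtain d2 where d2: "0 < d2"
      "\<And>h. 0 \<le> h \<Longrightarrow> h < d2 \<Longrightarrow> \<bar>integral {- x..- x + h} (\<lambda>x. f (- x)) - h * f x\<bar> \<le> e * h"
      by auto
    from N1(2)[OF _ e, of x] x obtain d1 where d1: "0 < d1"
      "\<And>h. 0 \<le> h \<Longrightarrow> h < d1 \<Longrightarrow> \<bar>integral {x..x + h} f - h * f x\<bar> \<le> e * h"
      by auto
    show "\<exists>d>0. \<forall>a b. a \<le> x \<and> x \<le> b \<and> b - a < d \<longrightarrow>
       \<bar>integral {a..b} f - (b - a) * f x\<bar> \<le> e * (b - a)"
    proof (intro exI conjI allI impI)
      show "0 < min d1 d2" using d1 d2 by simp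
      fix a b assume ab: "a \<le> x \<and> x \<le> b \<and> b - a < min d1 d2"
      have "\<bar>integral {x..b} f - (b - x) * f x\<bar> \<le> e * (b - x)"
        using d1(2)[of "b - x"] ab by simp
      moreover have "integral {- x..- x + (x - a)} (\<lambda>x. f (- x)) = integral {a..x} f"
        using Henstock_Kurzweil_Integration.integral_reflect_real[of x a f] by simp
      then have "\<bar>integral {a..x} f - (x - a) * f x\<bar> \<le> e * (x - a)"
        using d2(2)[of "x - a"] ab by simp
      moreover have "integral {a..b} f = integral {a..x} f + integral {x..b} f"
        using ab f by (simp add: Henstock_Kurzweil_Integration.integral_combine)
      ultimately have "\<bar>integral {a..b} f - (b - a) * f x\<bar> \<le> e * (b - x) + e * (x - a)"
        by (simp add: left_diff_distrib)
      then show "\<bar>integral {a..b} f - (b - a) * f x\<bar> \<le> e * (b - a)"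
        by (simp add: algebra_simps)
    qed
  qed
qed

section \<open>The cells and the averaging operator\<close>

lemma cell_subset_Icc: "1 \<le> i \<Longrightarrow> cell n i \<subseteq> {(real i - 1) / real n..real i / real n}"
  by (auto simp: cell_def)

lemma cell_subset_unit: "1 \<le> i \<Longrightarrow> i \<le> n \<Longrightarrow> cell n i \<subseteq> {0..1}"
  using cell_subset_Icc[of i n] by (rule order_trans) (auto simp: divide_le_eq)

lemma cell_borel [measurable]: "cell n i \<in> sets borel"
  by (simp add: cell_def)

lemma cell_in_sets_unit_leb: "1 \<le> i \<Longrightarrow> i \<le> n \<Longrightarrow> cell n i \<in> sets unit_leb"
  using cell_subset_unit[of i n] by (auto simp: sets_restrict_space_iff)

text \<open>The index is the ceiling of \<open>n * x\<close>, except in the first cell, which is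
  closed at 0 and where the ceiling could be 0.\<close>

lemma cell_cover:
  assumes n: "1 \<le> n" and x: "x \<in> {0..1}"
  obtains i where "i \<in> {1..n}" "x \<in> cell n i"
proof (cases "x \<le> 1 / real n")
  case True
  then show ?thesis using that[of 1] n x by (auto simp: cell_def)
next
  case False
  let ?i = "nat \<lceil>real n * x\<rceil>"
  have gt: "1 < real n * x" using False n by (simp add: field_simps)
  then have i: "2 \<le> ?i" by linarith
  have "real ?i - 1 < real n * x" "real n * x \<le> real ?i"
    using gt by linarith+
  moreover have "real n * x \<le> real n" using x by (simp add: mult_left_le)
  then have "?i \<le> n" by linarith
  ultimately show ?thesis using that[of ?i] i n
    by (auto simp: cell_def field_simps)
qed

lemma cell_unique:
  assumes "i \<in> {1..n}" "j \<in> {1..n}" "x \<in> cell n i" "x \<in> cell n j"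
  shows "i = j"
proof -
  have False if "i < j" "i \<in> {1..n}" "j \<in> {1..n}" "x \<in> cell n i" "x \<in> cell n j" for i j
  proof -
    have "x \<le> real i / real n" using cell_subset_Icc[of i n] that by auto
    also have "\<dots> \<le> (real j - 1) / real n" using that by (intro divide_right_mono) auto
    also have "\<dots> < x" using that by (auto simp: cell_def split: if_splits)
    finally show False by simp
  qed
  from this[of i j] this[of j i] assms show ?thesis by (cases i j rule: linorder_cases) auto
qed

lemma sum_indicator_cell:
  fixes c :: "nat \<Rightarrow> real"
  assumes "i \<in> {1..n}" "x \<in> cell n i"
  shows "(\<Sum>k=1..n. c k * indicator (cell n k) x) = c i"
proof -
  have "(\<Sum>k=1..n. c k * indicator (cell n k) x) = (\<Sum>k=1..n. if k = i then c k else 0)"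
    using assms cell_unique[of i n] by (intro sum.cong) (auto simp: indicator_def)
  then show ?thesis using assms by simp
qed

lemma measure_cell:
  assumes "1 \<le> i" "i \<le> n"
  shows "measure unit_leb (cell n i) = 1 / real n"
proof -
  have "measure unit_leb (cell n i) = measure lborel (cell n i)"
    using cell_subset_unit[OF assms] by (simp add: measure_restrict_space)
  then show ?thesis using assms by (auto simp: cell_def divide_right_mono diff_divide_distrib)
qed

lemma integral_cell:
  fixes p :: "real \<Rightarrow> real"
  assumes "1 \<le> i" "i \<le> n"
  shows "(LINT y|lebesgue_on (cell n i). p y) = (LINT y:cell n i|unit_leb. p y)"
  using cell_subset_unit[OF assms] unfolding set_lebesgue_integral_def
  by (subst (1 2) integral_restrict_space)
    (auto intro!: Bochner_Integration.integral_cong simp: indicator_def)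

lemma step_fun_cell:
  assumes "i \<in> {1..n}" "x \<in> cell n i"
  shows "step_fun p n x = real n * (LINT y:cell n i|unit_leb. p y)"
  unfolding step_fun_def sum_indicator_cell[OF assms] using assms by (simp add: integral_cell)

lemma step_fun_measurable [measurable]: "step_fun p n \<in> borel_measurable borel"
  unfolding step_fun_def by measurable

lemma measurable_unit_leb_borel: "f \<in> measurable borel N \<Longrightarrow> f \<in> measurable unit_leb N"
  by (intro measurable_restrict_space1 measurable_completion) simp

text \<open>An essential bound turns into a bound at every point of the interval, since averages
  ignore null sets.\<close>

lemma abs_step_fun_le:
  assumes p: "ess_bdd unit_leb B p" and n: "1 \<le> n" and x: "x \<in> {0..1}"
  shows "\<bar>step_fun p n x\<bar> \<le> B"
proof -
  obtain i where i: "i \<in> {1..n}" "x \<in> cell n i" using cell_cover[OF n x] .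
  have "\<bar>LINT y:cell n i|unit_leb. p y\<bar> \<le> B * measure unit_leb (cell n i)"
    using i by (intro unit_leb.abs_set_integral_le_ess_bdd p cell_in_sets_unit_leb) auto
  then have "real n * \<bar>LINT y:cell n i|unit_leb. p y\<bar> \<le> real n * (B * (1 / real n))"
    using i by (intro mult_left_mono) (auto simp: measure_cell)
  then show ?thesis using n by (simp add: step_fun_cell[OF i] abs_mult)
qed

lemma ess_bdd_step_fun:
  assumes p: "ess_bdd unit_leb B p"
  shows "ess_bdd unit_leb B (step_fun p n)"
proof -
  have "\<bar>step_fun p n x\<bar> \<le> B" if "x \<in> {0..1}" for x
  proof (cases "n = 0")
    \<comment> \<open>With no cells the sum is empty; covering \<open>n = 0\<close> keeps the
      sequences indexed by all naturals.\<close>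
    case True
    then show ?thesis using unit_leb.ess_bdd_nonneg[OF p] by (simp add: step_fun_def)
  next
    case False
    then show ?thesis using abs_step_fun_le[OF p _ that] by simp
  qed
  then show ?thesis
    using measurable_unit_leb_borel[OF step_fun_measurable[of p n]]
    by (auto simp: ess_bdd_def intro!: AE_I2)
qed

lemma step_fun_tendsto:
  assumes p: "integrable unit_leb p"
  shows "AE x in unit_leb. (\<lambda>n. step_fun p n x) \<longlonglongrightarrow> p x"
proof -
  define f where "f x = (if x \<in> {0..1} then p x else 0)" for x :: real
  have "integrable lebesgue (\<lambda>x. indicator {0..1} x *\<^sub>R p x)"
    using p by (subst (asm) integrable_restrict_space) auto
  also have "(\<lambda>x. indicator {0..1} x *\<^sub>R p x) = f" by (auto simp: f_def fun_eq_iff)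
  finally have f: "integrable lebesgue f" .
  have "f integrable_on {a..b}" for a b
    using integrable_on_lebesgue[OF f] by (rule integrable_on_subinterval) simp
  then obtain N where N: "negligible N"
    "\<And>x e. x \<notin> N \<Longrightarrow> 0 < e \<Longrightarrow> \<exists>d>0. \<forall>a b. a \<le> x \<and> x \<le> b \<and> b - a < d \<longrightarrow>
       \<bar>integral {a..b} f - (b - a) * f x\<bar> \<le> e * (b - a)"
    using interval_averages_tendsto[of f] by metis
  \<comment> \<open>A cell differs from its closure by at most the left endpoint, so its average is
    one to which the differentiation theorem applies.\<close>
  have cell_int: "(LINT y:cell n i|unit_leb. p y) = integral {(real i - 1) / real n..real i / real n} f"
    if i: "1 \<le> i" "i \<le> n" for n i
  proof -
    let ?J = "{(real i - 1) / real n..real i / real n}"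
    have J: "?J \<subseteq> {0..1}" using i by (auto simp: field_simps intro: order_trans)
    have fJ: "integrable (lebesgue_on ?J) f"
      using integrable_indicator_mult[OF f, of ?J] by (simp add: integrable_restrict_space)
    have "(LINT y:cell n i|unit_leb. p y) = (LINT y|lebesgue_on (cell n i). p y)"
      using integral_cell[OF i] by simp
    also have "\<dots> = (LINT y|lebesgue. indicator (cell n i) y *\<^sub>R p y)"
      by (rule integral_restrict_space) simp
    also have "\<dots> = (LINT y|lebesgue. indicator ?J y *\<^sub>R f y)"
    proof (rule integral_cong_AE)
      have eq: "(\<lambda>y. indicator (cell n i) y *\<^sub>R p y) = (\<lambda>y. indicator (cell n i) y *\<^sub>R f y)"
        using cell_subset_unit[OF i] by (auto simp: fun_eq_iff f_def indicator_def)
      show "(\<lambda>y. indicator (cell n i) y *\<^sub>R p y) \<in> borel_measurable lebesgue"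
        unfolding eq using f by (intro borel_measurable_scaleR borel_measurable_indicator) auto
      show "(\<lambda>y. indicator ?J y *\<^sub>R f y) \<in> borel_measurable lebesgue"
        using f by (intro borel_measurable_scaleR borel_measurable_indicator) auto
      have "AE y in lebesgue. y \<noteq> (real i - 1) / real n"
        by (intro AE_completion AE_lborel_singleton)
      then show "AE y in lebesgue. indicator (cell n i) y *\<^sub>R p y = indicator ?J y *\<^sub>R f y"
      proof eventually_elim
        case (elim y)
        then have "y \<in> cell n i \<longleftrightarrow> y \<in> ?J" using i by (auto simp: cell_def)
        then show ?case using eq by (metis indicator_simps)
      qed
    qed
    also have "\<dots> = integral\<^sup>L (lebesgue_on ?J) f"
      by (rule integral_restrict_space[symmetric]) simp
    also have "\<dots> = integral ?J f" by (rule lebesgue_integral_eq_integral[OF fJ]) simp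
    finally show ?thesis .
  qed
  have "AE x in lebesgue. x \<notin> N"
    using N(1) by (simp add: negligible_iff_null_sets AE_not_in)
  then have "AE x in unit_leb. x \<notin> N" by (simp add: AE_lebesgue_on_iff eventually_mono)
  with AE_space show ?thesis
  proof eventually_elim
    case (elim x)
    then have x: "x \<in> {0..1}" "f x = p x" by (auto simp: f_def)
    show ?case
    proof (rule LIMSEQ_I)
      fix e :: real assume e: "0 < e"
      then obtain d where d: "0 < d" "\<And>a b. a \<le> x \<Longrightarrow> x \<le> b \<Longrightarrow> b - a < d \<Longrightarrow>
          \<bar>integral {a..b} f - (b - a) * p x\<bar> \<le> e / 2 * (b - a)"
        using N(2)[OF elim(2), of "e / 2"] x by auto
      obtain m where m: "1 / d < real m" using reals_Archimedean2 by blast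
      show "\<exists>m. \<forall>n\<ge>m. norm (step_fun p n x - p x) < e"
      proof (intro exI allI impI)
        fix n assume "Suc m \<le> n"
        then have n: "1 \<le> n" "1 / d < real n" using m by auto
        then have nd: "1 / real n < d" using d(1) by (simp add: field_simps)
        obtain i where i: "i \<in> {1..n}" "x \<in> cell n i" using cell_cover[OF n(1) x(1)] .
        let ?I = "integral {(real i - 1) / real n..real i / real n} f"
        have len: "real i / real n - (real i - 1) / real n = 1 / real n"
          by (simp add: diff_divide_distrib)
        have "\<bar>?I - 1 / real n * p x\<bar> \<le> e / 2 * (1 / real n)"
          using d(2)[of "(real i - 1) / real n" "real i / real n"] cell_subset_Icc[of i n] i nd
          unfolding len by auto
        then have "real n * \<bar>?I - 1 / real n * p x\<bar> \<le> real n * (e / 2 * (1 / real n))"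
          by (intro mult_left_mono) auto
        moreover have "real n * \<bar>?I - 1 / real n * p x\<bar> = \<bar>real n * (?I - 1 / real n * p x)\<bar>"
          by (simp add: abs_mult)
        moreover have "real n * (?I - 1 / real n * p x) = step_fun p n x - p x"
          using n i by (simp add: step_fun_cell[OF i] cell_int right_diff_distrib)
        ultimately show "norm (step_fun p n x - p x) < e" using n e by simp
      qed
    qed
  qed
qed

subsection \<open>Step kernels\<close>

lemma step_kernel_cell:
  assumes "i \<in> {1..n}" "x \<in> cell n i" "j \<in> {1..n}" "y \<in> cell n j"
  shows "step_kernel K n x y = step_coeff K n i j"
  unfolding step_kernel_def sum_indicator_cell[OF assms(3,4)] sum_indicator_cell[OF assms(1,2)] ..

text \<open>Borel measurability on the plane passes to the product of the two Lebesgue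
  sigma-algebras, whereas a Lebesgue measurable function of two variables need not be measurable for
  that product. Step kernels again satisfy these conditions, so every result applies to them
  too.\<close>

locale unit_kernel =
  fixes K :: "real \<Rightarrow> real \<Rightarrow> real"
  assumes K_borel: "case_prod K \<in> borel_measurable borel"
    and K_bound: "\<bar>K x y\<bar> \<le> 1"
begin

lemma bounded_kernel: "bounded_kernel unit_leb K"
proof (intro bounded_kernel.intro bounded_kernel_axioms.intro prob_space_unit_leb K_bound)
  have [measurable]: "fst \<in> borel_measurable (unit_leb \<Otimes>\<^sub>M unit_leb)"
    "snd \<in> borel_measurable (unit_leb \<Otimes>\<^sub>M unit_leb)"
    using measurable_compose[OF measurable_fst measurable_unit_leb_borel[OF measurable_ident_sets]]
      measurable_compose[OF measurable_snd measurable_unit_leb_borel[OF measurable_ident_sets]]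
    by auto
  have "(\<lambda>p. (fst p, snd p)) \<in> (unit_leb \<Otimes>\<^sub>M unit_leb) \<rightarrow>\<^sub>M (borel :: (real \<times> real) measure)"
    unfolding borel_prod[symmetric] by measurable
  from measurable_compose[OF this K_borel]
  show "case_prod K \<in> borel_measurable (unit_leb \<Otimes>\<^sub>M unit_leb)" by simp
qed

sublocale bounded_kernel unit_leb K
  by (rule bounded_kernel)

lemma kernel_op_indicator:
  assumes B: "B \<in> sets borel" "B \<subseteq> {0..1}"
  shows "kernel_op unit_leb K (indicator B) x = (LINT y|lborel. indicator B y * K x y)"
proof -
  have "(\<lambda>y. K x y) \<in> borel_measurable borel"
    using measurable_compose[OF _ K_borel, of "\<lambda>y. (x, y)"] by simp
  then have [measurable]: "(\<lambda>y. indicator B y * K x y) \<in> borel_measurable lborel"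
    using B by measurable
  have "kernel_op unit_leb K (indicator B) x
      = (LINT y|lebesgue. indicator {0..1} y *\<^sub>R (K x y * indicator B y))"
    unfolding kernel_op_def by (rule integral_restrict_space) simp
  also have "\<dots> = (LINT y|lebesgue. indicator B y * K x y)"
    using B by (intro Bochner_Integration.integral_cong) (auto simp: indicator_def)
  also have "\<dots> = (LINT y|lborel. indicator B y * K x y)"
    by (rule integral_completion) measurable
  finally show ?thesis .
qed

text \<open>Fubini, carried out for \<open>lborel\<close> after leaving the completions. It
  expresses the double integrals in \<open>step_coeff\<close> through
  \<open>kernel_op\<close>.\<close>

lemma integral_rectangle:
  assumes A: "A \<in> sets borel" "A \<subseteq> {0..1}" and B: "B \<in> sets borel" "B \<subseteq> {0..1}"
  shows "(LINT p|lebesgue_on (A \<times> B). K (fst p) (snd p))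
    = (LINT x:A|unit_leb. kernel_op unit_leb K (indicator B) x)"
proof -
  have [measurable]: "A \<in> sets borel" "B \<in> sets borel" using A B by auto
  have AB: "A \<times> B \<in> sets borel" using A B by (auto intro: borel_Times)
  let ?f = "\<lambda>p. indicator (A \<times> B) p * case_prod K p"
  have f[measurable]: "?f \<in> borel_measurable (borel :: (real \<times> real) measure)"
    using AB K_borel by measurable
  have AB_sub: "emeasure (lborel :: (real \<times> real) measure) (A \<times> B) < \<infinity>"
    using A B by (intro emeasure_bounded_finite bounded_Times) (auto intro: bounded_subset[of "{0..1}"])
  have "integrable lborel (\<lambda>p. indicator (A \<times> B) p *\<^sub>R case_prod K p)"
    using AB AB_sub K_borel K_bound
    by (intro integrableI_bounded_set_indicator[where B = 1]) auto
  then have int: "integrable (lborel \<Otimes>\<^sub>M lborel) ?f" by (simp add: lborel_prod)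
  let ?h = "\<lambda>x. LINT y|lborel. indicator B y * K x y"
  have h: "?h \<in> borel_measurable borel"
  proof -
    have "(\<lambda>(x, y). indicator B y * K x y) \<in> borel_measurable (borel \<Otimes>\<^sub>M lborel)"
    proof -
      have [measurable]: "case_prod K \<in> borel_measurable (borel \<Otimes>\<^sub>M borel)"
        using K_borel by (simp add: borel_prod)
      have "(\<lambda>p. indicator B (snd p) * case_prod K p) \<in> borel_measurable (borel \<Otimes>\<^sub>M borel)"
        by measurable
      then have "(\<lambda>p. indicator B (snd p) * case_prod K p) \<in> borel_measurable (borel \<Otimes>\<^sub>M lborel)"
        by (simp cong: measurable_cong_sets)
      then show ?thesis by (simp add: case_prod_beta)
    qed
    then show ?thesis by (rule lborel.borel_measurable_lebesgue_integral)
  qed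
  have "(LINT p|lebesgue_on (A \<times> B). K (fst p) (snd p))
      = (LINT p|lebesgue. indicator (A \<times> B) p *\<^sub>R K (fst p) (snd p))"
    using AB by (intro integral_restrict_space) simp
  also have "\<dots> = (LINT p|lebesgue. ?f p)" by (simp add: case_prod_beta)
  also have "\<dots> = (LINT p|lborel. ?f p)" by (rule integral_completion) simp
  also have "\<dots> = (LINT p|(lborel \<Otimes>\<^sub>M lborel). ?f p)" by (simp add: lborel_prod)
  also have "\<dots> = (LINT x|lborel. (LINT y|lborel. ?f (x, y)))"
    by (rule lborel_pair.integral_fst'[OF int, symmetric])
  also have "\<dots> = (LINT x|lborel. indicator A x * ?h x)"
    by (simp add: indicator_times mult.assoc)
  also have "\<dots> = (LINT x|lebesgue. indicator A x * ?h x)"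
    by (intro integral_completion[symmetric] borel_measurable_times borel_measurable_indicator)
      (use h A in simp_all)
  also have "\<dots> = (LINT x|lebesgue. indicator {0..1} x *\<^sub>R (indicator A x *\<^sub>R ?h x))"
    using A by (intro Bochner_Integration.integral_cong) (auto simp: indicator_def)
  also have "\<dots> = (LINT x:A|unit_leb. ?h x)"
    unfolding set_lebesgue_integral_def by (rule integral_restrict_space[symmetric]) simp
  finally show ?thesis unfolding kernel_op_indicator[OF B] .
qed

lemma step_coeff_eq:
  assumes "i \<in> {1..n}" "j \<in> {1..n}"
  shows "step_coeff K n i j
    = (real n)\<^sup>2 * (LINT x:cell n i|unit_leb. kernel_op unit_leb K (indicator (cell n j)) x)"
  unfolding step_coeff_def using assms
  by (subst integral_rectangle) (simp_all add: cell_subset_unit)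

lemma ess_bdd_kernel_op_indicator:
  assumes "E \<in> sets unit_leb"
  shows "ess_bdd unit_leb (measure unit_leb E) (kernel_op unit_leb K (indicator E))"
proof -
  have i: "integrable unit_leb (indicator E :: real \<Rightarrow> real)"
    using assms by (simp add: less_top[symmetric])
  have "\<bar>kernel_op unit_leb K (indicator E) x\<bar> \<le> measure unit_leb E" if "x \<in> space unit_leb" for x
  proof -
    have "E \<inter> {0..1} = E" using sets.sets_into_space[OF assms] by auto
    then show ?thesis using abs_kernel_op_le[OF i that] by simp
  qed
  then show ?thesis
    using kernel_op_measurable[of "indicator E"] assms by (auto simp: ess_bdd_def intro!: AE_I2)
qed

text \<open>The factor \<open>n^2\<close> is the reciprocal of the area of the product of two cells,
  so the coefficient is an average of values in \<open>[-1,1]\<close>.\<close>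

lemma abs_step_coeff_le:
  assumes ij: "i \<in> {1..n}" "j \<in> {1..n}"
  shows "\<bar>step_coeff K n i j\<bar> \<le> 1"
proof -
  have E: "cell n i \<in> sets unit_leb" "cell n j \<in> sets unit_leb"
    using ij cell_in_sets_unit_leb by auto
  have "\<bar>LINT x:cell n i|unit_leb. kernel_op unit_leb K (indicator (cell n j)) x\<bar>
      \<le> measure unit_leb (cell n j) * measure unit_leb (cell n i)"
    by (intro unit_leb.abs_set_integral_le_ess_bdd ess_bdd_kernel_op_indicator E)
  then have "(real n)\<^sup>2 * \<bar>LINT x:cell n i|unit_leb. kernel_op unit_leb K (indicator (cell n j)) x\<bar>
      \<le> (real n)\<^sup>2 * (1 / real n * (1 / real n))"
    using ij by (intro mult_left_mono) (auto simp: measure_cell)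
  then show ?thesis using ij by (simp add: step_coeff_eq abs_mult power2_eq_square)
qed

lemma step_kernel_borel: "case_prod (step_kernel K n) \<in> borel_measurable borel"
proof -
  have "(\<lambda>p. step_kernel K n (fst p) (snd p)) \<in> borel_measurable (borel \<Otimes>\<^sub>M borel)"
    unfolding step_kernel_def by measurable
  then show ?thesis by (simp add: borel_prod case_prod_beta)
qed

text \<open>Off the cells the kernel vanishes, so the bound holds on the whole plane.\<close>

lemma abs_step_kernel_le: "\<bar>step_kernel K n x y\<bar> \<le> 1"
proof (cases "(\<exists>i\<in>{1..n}. x \<in> cell n i) \<and> (\<exists>j\<in>{1..n}. y \<in> cell n j)")
  case True
  then show ?thesis by (auto simp: step_kernel_cell abs_step_coeff_le)
next
  case False
  then have "step_kernel K n x y = 0"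
    unfolding step_kernel_def by (intro sum.neutral ballI) (auto simp: indicator_def)
  then show ?thesis by simp
qed

lemma unit_kernel_step_kernel: "unit_kernel (step_kernel K n)"
  by (intro unit_kernel.intro step_kernel_borel abs_step_kernel_le)

text \<open>The factorization is exact and holds for every real \<open>x\<close>, both sides being
  zero outside the cells. Both expand into the same double sum over cells.\<close>

lemma kernel_op_step_kernel:
  assumes p: "ess_bdd unit_leb B p"
  shows "kernel_op unit_leb (step_kernel K n) p x
    = step_fun (kernel_op unit_leb K (step_fun p n)) n x"
proof -
  define P where "P j = (LINT y:cell n j|unit_leb. p y)" for j
  define k where "k j = kernel_op unit_leb K (indicator (cell n j))" for j
  have ip: "integrable unit_leb p" using p by (rule unit_leb.ess_bdd_integrable)
  have E: "cell n i \<in> sets unit_leb" if "i \<in> {1..n}" for i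
    using that cell_in_sets_unit_leb by auto
  have ik: "integrable unit_leb (k j)" if "j \<in> {1..n}" for j
    unfolding k_def
    by (rule unit_leb.ess_bdd_integrable[OF ess_bdd_kernel_op_indicator[OF E[OF that]]])
  have inner: "(LINT x|lebesgue_on (cell n i). kernel_op unit_leb K (step_fun p n) x)
      = (\<Sum>j=1..n. real n * P j * (LINT x:cell n i|unit_leb. k j x))" if i: "i \<in> {1..n}" for i
  proof -
    have s: "step_fun p n = (\<lambda>y. \<Sum>j=1..n. real n * P j * indicator (cell n j) y)"
      unfolding step_fun_def P_def by (auto simp: integral_cell fun_eq_iff intro!: sum.cong)
    have "(LINT x|lebesgue_on (cell n i). kernel_op unit_leb K (step_fun p n) x)
        = (LINT x:cell n i|unit_leb. kernel_op unit_leb K (step_fun p n) x)"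
      using i by (intro integral_cell) auto
    also have "\<dots> = (LINT x:cell n i|unit_leb. (\<Sum>j=1..n. real n * P j * k j x))"
    proof (rule set_lebesgue_integral_cong[OF E[OF i]], intro allI impI)
      fix x assume "x \<in> cell n i"
      then have "x \<in> space unit_leb" using cell_subset_unit[of i n] i by auto
      then show "kernel_op unit_leb K (step_fun p n) x = (\<Sum>j=1..n. real n * P j * k j x)"
        unfolding s k_def using E by (intro kernel_op_sum) (auto simp: less_top[symmetric])
    qed
    also have "\<dots> = (LINT x|unit_leb. (\<Sum>j=1..n. real n * P j * (indicator (cell n i) x * k j x)))"
      by (simp add: set_lebesgue_integral_def sum_distrib_left ac_simps)
    also have "\<dots> = (\<Sum>j=1..n. LINT x|unit_leb. real n * P j * (indicator (cell n i) x * k j x))"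
      by (intro Bochner_Integration.integral_sum integrable_mult_right integrable_indicator_mult ik E i)
    finally show ?thesis by (simp add: set_lebesgue_integral_def)
  qed
  have "kernel_op unit_leb (step_kernel K n) p x
      = (LINT y|unit_leb. (\<Sum>i=1..n. \<Sum>j=1..n. step_coeff K n i j * indicator (cell n i) x * (indicator (cell n j) y * p y)))"
    by (simp add: kernel_op_def step_kernel_def sum_distrib_right mult.assoc)
  also have "\<dots> = (\<Sum>i=1..n. \<Sum>j=1..n. LINT y|unit_leb. step_coeff K n i j * indicator (cell n i) x * (indicator (cell n j) y * p y))"
    by (subst Bochner_Integration.integral_sum, intro Bochner_Integration.integrable_sum
        integrable_mult_right integrable_indicator_mult ip E, assumption,
        intro sum.cong refl Bochner_Integration.integral_sum
        integrable_mult_right integrable_indicator_mult ip E)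
  also have "\<dots> = (\<Sum>i=1..n. \<Sum>j=1..n. step_coeff K n i j * indicator (cell n i) x * P j)"
    by (simp add: P_def set_lebesgue_integral_def)
  \<comment> \<open>Of the factor \<open>n^2\<close> in \<open>step_coeff\<close>, one
    \<open>n\<close> belongs to the average of \<open>p\<close> and the other to the outer
    average.\<close>
  also have "\<dots> = (\<Sum>i=1..n. real n * (\<Sum>j=1..n. real n * P j * (LINT x:cell n i|unit_leb. k j x)) * indicator (cell n i) x)"
    by (intro sum.cong refl)
      (simp add: step_coeff_eq k_def sum_distrib_left sum_distrib_right power2_eq_square ac_simps)
  also have "\<dots> = step_fun (kernel_op unit_leb K (step_fun p n)) n x"
    unfolding step_fun_def[of "kernel_op unit_leb K (step_fun p n)"]
    by (intro sum.cong refl) (simp only: inner)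
  finally show ?thesis .
qed

text \<open>Three errors: replacing \<open>p n\<close> by \<open>q\<close> costs their L1 distance;
  removing the inner average costs the L1 distance of \<open>q\<close> to its average, since the
  outer average does not increase a uniform bound; removing the outer average is Lebesgue
  differentiation of \<open>kernel_op unit_leb K q\<close>. Only the last depends on
  \<open>x\<close>.\<close>

lemma kernel_op_step_kernel_tendsto:
  assumes p: "\<And>n. ess_bdd unit_leb B (p n)" "ess_bdd unit_leb B q"
    and lim: "AE x in unit_leb. (\<lambda>n. p n x) \<longlonglongrightarrow> q x"
  shows "AE x in unit_leb. (\<lambda>n. kernel_op unit_leb (step_kernel K n) (p n) x)
    \<longlonglongrightarrow> kernel_op unit_leb K q x"
proof -
  let ?T = "kernel_op unit_leb K" and ?T' = "\<lambda>n. kernel_op unit_leb (step_kernel K n)"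
  define d where "d n = (LINT x|unit_leb. \<bar>p n x - q x\<bar>)" for n
  define d' where "d' n = (LINT x|unit_leb. \<bar>step_fun q n x - q x\<bar>)" for n
  have ip: "integrable unit_leb (p n)" and iq: "integrable unit_leb q"
    and isq: "integrable unit_leb (step_fun q n)" for n
    by (rule unit_leb.ess_bdd_integrable, rule p ess_bdd_step_fun[OF p(2)])+
  have Tq: "ess_bdd unit_leb B (?T q)" by (intro ess_bdd_kernel_op p)
  then have iTq: "integrable unit_leb (?T q)" by (rule unit_leb.ess_bdd_integrable)
  have d: "d \<longlonglongrightarrow> 0"
    unfolding d_def using p lim by (intro unit_leb.L1_tendsto_of_ess_bdd)
  have d': "d' \<longlonglongrightarrow> 0"
    unfolding d'_def
    using ess_bdd_step_fun[OF p(2)] p(2) step_fun_tendsto[OF iq]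
    by (intro unit_leb.L1_tendsto_of_ess_bdd)
  have bound: "\<bar>?T' n (p n) x - ?T q x\<bar> \<le> d n + d' n + \<bar>step_fun (?T q) n x - ?T q x\<bar>"
    if x: "x \<in> {0..1}" and n: "1 \<le> n" for n x
  proof -
    interpret S: unit_kernel "step_kernel K n" by (rule unit_kernel_step_kernel)
    have "\<bar>?T' n (p n) x - ?T' n q x\<bar> \<le> d n"
      unfolding d_def using S.abs_kernel_op_le[of "\<lambda>y. p n y - q y" x] ip iq x
      by (simp add: S.kernel_op_diff)
    moreover have "\<bar>?T' n q x - step_fun (?T q) n x\<bar> \<le> d' n"
    proof -
      have sq: "ess_bdd unit_leb B (?T (step_fun q n))"
        by (intro ess_bdd_kernel_op ess_bdd_step_fun p)
      obtain i where i: "i \<in> {1..n}" "x \<in> cell n i" using cell_cover[OF n x] .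
      have E: "cell n i \<in> sets unit_leb" using i cell_in_sets_unit_leb by auto
      have "ess_bdd unit_leb (d' n) (\<lambda>y. ?T (step_fun q n) y - ?T q y)"
      proof -
        have "\<bar>?T (step_fun q n) y - ?T q y\<bar> \<le> d' n" if "y \<in> space unit_leb" for y
          using abs_kernel_op_le[of "\<lambda>y. step_fun q n y - q y" y] kernel_op_diff[OF isq iq that] isq iq that
          by (simp add: d'_def)
        then show ?thesis
          using ess_bdd_measurable[OF sq] ess_bdd_measurable[OF Tq]
          by (auto simp: ess_bdd_def intro!: AE_I2)
      qed
      from abs_step_fun_le[OF this n x]
      have "\<bar>step_fun (\<lambda>y. ?T (step_fun q n) y - ?T q y) n x\<bar> \<le> d' n" .
      moreover have "step_fun (\<lambda>y. ?T (step_fun q n) y - ?T q y) n x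
          = step_fun (?T (step_fun q n)) n x - step_fun (?T q) n x"
        using integrable_indicator_mult[OF iTq E]
          integrable_indicator_mult[OF unit_leb.ess_bdd_integrable[OF sq] E]
        by (simp add: step_fun_cell[OF i] set_lebesgue_integral_def right_diff_distrib)
      ultimately show ?thesis by (simp add: kernel_op_step_kernel[OF p(2)])
    qed
    ultimately show ?thesis by linarith
  qed
  show ?thesis
    using step_fun_tendsto[OF iTq] AE_space
  proof eventually_elim
    case (elim x)
    have "(\<lambda>n. \<bar>step_fun (?T q) n x - ?T q x\<bar>) \<longlonglongrightarrow> 0"
      using elim(1) by (simp add: LIM_zero tendsto_rabs_zero)
    with d d' have lim0: "(\<lambda>n. d n + d' n + \<bar>step_fun (?T q) n x - ?T q x\<bar>) \<longlonglongrightarrow> 0"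
      by (auto intro!: tendsto_add_zero)
    have "(\<lambda>n. ?T' n (p n) x - ?T q x) \<longlonglongrightarrow> 0"
      using bound[of x] elim(2)
      by (intro Lim_null_comparison[OF _ lim0] eventually_sequentiallyI[of 1]) auto
    then show ?case by (rule LIM_zero_cancel)
  qed
qed

text \<open>The degree functions of the step kernels converge by the previous result for the
  constant 1. The product with \<open>p n\<close> is where pointwise convergence of
  \<open>p n\<close> itself enters.\<close>

lemma voting_op_step_kernel_tendsto:
  assumes p: "\<And>n. ess_bdd unit_leb B (p n)" "ess_bdd unit_leb B q"
    and lim: "AE x in unit_leb. (\<lambda>n. p n x) \<longlonglongrightarrow> q x"
  shows "AE x in unit_leb. (\<lambda>n. voting_op unit_leb (step_kernel K n) (p n) x)
    \<longlonglongrightarrow> voting_op unit_leb K q x"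
proof -
  have one: "ess_bdd unit_leb 1 (\<lambda>_. 1)" by (simp add: ess_bdd_def)
  have "AE x in unit_leb. (\<lambda>n. kernel_op unit_leb (step_kernel K n) (\<lambda>_. 1) x)
      \<longlonglongrightarrow> kernel_op unit_leb K (\<lambda>_. 1) x"
    by (rule kernel_op_step_kernel_tendsto[OF one one]) simp
  with kernel_op_step_kernel_tendsto[OF assms] AE_space lim show ?thesis
  proof eventually_elim
    case (elim x)
    have eq: "voting_op unit_leb (step_kernel K n) (p n) x = kernel_op unit_leb (step_kernel K n) (p n) x
        - p n x * kernel_op unit_leb (step_kernel K n) (\<lambda>_. 1) x" for n
    proof -
      interpret S: unit_kernel "step_kernel K n" by (rule unit_kernel_step_kernel)
      show ?thesis by (rule S.voting_op_eq[OF unit_leb.ess_bdd_integrable[OF p(1)] elim(2)])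
    qed
    show ?case
      unfolding eq voting_op_eq[OF unit_leb.ess_bdd_integrable[OF p(2)] elim(2)]
      by (intro tendsto_diff tendsto_mult elim)
  qed
qed

lemma voting_op_funpow_step_tendsto:
  assumes g: "ess_bdd unit_leb B g"
  shows "AE x in unit_leb. (\<lambda>n. (voting_op unit_leb (step_kernel K n) ^^ k) (step_fun g n) x)
    \<longlonglongrightarrow> (voting_op unit_leb K ^^ k) g x"
proof (induction k)
  case 0
  then show ?case using step_fun_tendsto[OF unit_leb.ess_bdd_integrable[OF g]] by simp
next
  case (Suc k)
  have "ess_bdd unit_leb (2 ^ k * B) ((voting_op unit_leb (step_kernel K n) ^^ k) (step_fun g n))" for n
  proof -
    interpret S: unit_kernel "step_kernel K n" by (rule unit_kernel_step_kernel)
    show ?thesis by (intro S.ess_bdd_voting_op_funpow ess_bdd_step_fun g)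
  qed
  from voting_op_step_kernel_tendsto[OF this ess_bdd_voting_op_funpow[OF g] Suc]
  show ?case by simp
qed

end

section \<open>Replacing the kernel by a Borel version\<close>

lemma voting_kernel_borel_version:
  assumes W: "voting_kernel W"
  obtains K where "unit_kernel K"
    "AE p in lebesgue_on ({0..1} \<times> {0..1}). W (fst p) (snd p) = K (fst p) (snd p)"
proof -
  let ?Q = "{0..1} \<times> {0..1} :: (real \<times> real) set"
  have Q: "?Q \<in> sets lebesgue" by (intro sets_completionI_sets) (simp add: borel_Times)
  have "(\<lambda>p. if p \<in> ?Q then W (fst p) (snd p) else 0) \<in> borel_measurable lebesgue"
    using W borel_measurable_if[OF Q, of "\<lambda>p. W (fst p) (snd p)"]
    by (simp add: voting_kernel_def case_prod_beta')
  from completion_ex_borel_measurable_real[OF this]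
  obtain f where f: "f \<in> borel_measurable lborel"
    "AE p in lborel. (if p \<in> ?Q then W (fst p) (snd p) else 0) = f p" by blast
  \<comment> \<open>Clamping gives the bound at every point and changes nothing where
    \<open>f\<close> agrees with \<open>W\<close>, whose values on the square lie in
    \<open>[-1,1]\<close>.\<close>
  define K where "K x y = max (- 1) (min 1 (f (x, y)))" for x y :: real
  show thesis
  proof (rule that)
    have "case_prod K = (\<lambda>p. max (- 1) (min 1 (f p)))" by (auto simp: K_def)
    then show "unit_kernel K"
      using f(1) by (intro unit_kernel.intro) (auto simp: K_def)
    have "AE p in lebesgue. (if p \<in> ?Q then W (fst p) (snd p) else 0) = f p"
      using f(2) by (rule AE_completion)
    then show "AE p in lebesgue_on ?Q. W (fst p) (snd p) = K (fst p) (snd p)"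
      unfolding AE_lebesgue_on_iff[OF Q]
    proof eventually_elim
      case (elim p)
      show ?case
      proof
        assume p: "p \<in> ?Q"
        then have "W (fst p) (snd p) \<in> {- 1..1}" using W by (auto simp: voting_kernel_def)
        then show "W (fst p) (snd p) = K (fst p) (snd p)" using elim p by (simp add: K_def)
      qed
    qed
  qed
qed

lemma AE_square_imp_AE_AE:
  assumes "AE p in lebesgue_on ({0..1} \<times> {0..1}). P (fst p) (snd p)"
  shows "AE x in unit_leb. AE y in unit_leb. P x y"
proof -
  let ?Q = "{0..1} \<times> {0..1} :: (real \<times> real) set"
  have Q: "?Q \<in> sets lebesgue" by (intro sets_completionI_sets) (simp add: borel_Times)
  have "AE p in lborel. p \<in> ?Q \<longrightarrow> P (fst p) (snd p)"
    using assms by (simp add: AE_lebesgue_on_iff[OF Q] AE_completion_iff)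
  then have "AE p in (lborel \<Otimes>\<^sub>M lborel). p \<in> ?Q \<longrightarrow> P (fst p) (snd p)"
    unfolding lborel_prod .
  from lborel_pair.AE_pair[OF this]
  have "AE x in lebesgue. AE y in lebesgue. (x, y) \<in> ?Q \<longrightarrow> P x y"
    by (simp add: AE_completion_iff)
  then have "AE x in lebesgue. x \<in> {0..1} \<longrightarrow> (AE y in lebesgue. y \<in> {0..1} \<longrightarrow> P x y)"
    by eventually_elim (auto elim: eventually_mono)
  then show ?thesis by (simp add: AE_lebesgue_on_iff)
qed

text \<open>The coefficients are integrals, so the null set where \<open>W\<close> and
  \<open>K\<close> differ leaves no trace: the step kernels are equal everywhere.\<close>

lemma step_kernel_cong:
  assumes W: "voting_kernel W" and K: "unit_kernel K"
    and eq: "AE p in lebesgue_on ({0..1} \<times> {0..1}). W (fst p) (snd p) = K (fst p) (snd p)"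
  shows "step_kernel W n = step_kernel K n"
proof -
  let ?Q = "{0..1} \<times> {0..1} :: (real \<times> real) set"
  have Q: "?Q \<in> sets lebesgue" by (intro sets_completionI_sets) (simp add: borel_Times)
  have "step_coeff W n i j = step_coeff K n i j" if ij: "i \<in> {1..n}" "j \<in> {1..n}" for i j
  proof -
    let ?R = "cell n i \<times> cell n j"
    have R: "?R \<in> sets lebesgue" by (intro sets_completionI_sets) (simp add: borel_Times)
    have sub: "?R \<subseteq> ?Q" using ij cell_subset_unit[of i n] cell_subset_unit[of j n] by auto
    have "(\<lambda>p. W (fst p) (snd p)) \<in> borel_measurable (lebesgue_on ?Q)"
      using W by (simp add: voting_kernel_def case_prod_beta')
    then have m: "(\<lambda>p. W (fst p) (snd p)) \<in> borel_measurable (lebesgue_on ?R)"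
      using sub by (rule measurable_restrict_mono)
    have ae: "AE p in lebesgue_on ?R. W (fst p) (snd p) = K (fst p) (snd p)"
      using eq sub unfolding AE_lebesgue_on_iff[OF Q] AE_lebesgue_on_iff[OF R]
      by (auto elim!: eventually_mono)
    have "(\<lambda>p. K (fst p) (snd p)) \<in> borel_measurable (lebesgue_on ?R)"
      by (rule borel_measurable_lebesgue_on_AE[OF m R ae])
    from integral_cong_AE[OF m this ae] show ?thesis unfolding step_coeff_def by simp
  qed
  then show ?thesis unfolding step_kernel_def by (intro ext sum.cong refl) simp
qed

section \<open>Exceptional sets in the square\<close>

lemma measure_lborel_Times:
  fixes A B :: "real set"
  assumes "A \<in> sets borel" "B \<in> sets borel"
  shows "measure lborel (A \<times> B) = measure lborel A * measure lborel B"
  using lborel.emeasure_pair_measure_Times[of A lborel B] assms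
  by (simp add: lborel_prod measure_def enn2real_mult)

text \<open>A pair is bad as soon as one coordinate is, hence two cylinders and the factor 2. The
  set is first enlarged to a Borel set of the same measure, for which the product formula is
  available.\<close>

lemma unit_leb_cylinders_cover:
  assumes A: "A \<in> sets unit_leb"
  obtains C where "C \<in> sets lebesgue" "C \<subseteq> {0..1} \<times> {0..1}"
    "A \<times> {0..1} \<subseteq> C" "{0..1} \<times> A \<subseteq> C" "measure lebesgue C \<le> 2 * measure unit_leb A"
proof -
  have sub: "A \<subseteq> {0..1}" and "A \<in> sets lebesgue"
    using A by (auto simp: sets_restrict_space_iff)
  then obtain A' where A': "A' \<in> sets borel" "A \<subseteq> A'" "emeasure lebesgue A = emeasure lborel A'"
    using completion_upper[of A lborel] by (metis sets_lborel)
  define U where "U = A' \<inter> {0..1}"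
  have U: "U \<in> sets borel" "A \<subseteq> U" "U \<subseteq> {0..1}" using A' sub by (auto simp: U_def)
  have "measure lborel U \<le> measure unit_leb A"
  proof -
    have "emeasure lborel U \<le> emeasure lborel A'"
      using A' by (intro emeasure_mono) (auto simp: U_def)
    also have "\<dots> = emeasure unit_leb A" using A' sub by (simp add: emeasure_restrict_space)
    finally show ?thesis
      unfolding measure_def by (rule enn2real_mono) (simp add: less_top[symmetric])
  qed
  moreover have "measure lebesgue (U \<times> {0..1::real}) = measure lborel U"
    using borel_Times[OF U(1), of "{0..1::real}"] measure_lborel_Times[OF U(1), of "{0..1}"]
    by (simp add: measure_completion)
  moreover have "measure lebesgue ({0..1::real} \<times> U) = measure lborel U"
    using borel_Times[OF _ U(1), of "{0..1::real}"] measure_lborel_Times[OF _ U(1), of "{0..1}"]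
    by (simp add: measure_completion)
  ultimately have m: "measure lebesgue (U \<times> {0..1::real}) \<le> measure unit_leb A"
    "measure lebesgue ({0..1::real} \<times> U) \<le> measure unit_leb A" by simp_all
  have s: "U \<times> {0..1::real} \<in> sets lebesgue" "{0..1::real} \<times> U \<in> sets lebesgue"
    using U by (auto intro!: sets_completionI_sets borel_Times)
  show thesis
  proof (rule that)
    show "U \<times> {0..1} \<union> {0..1} \<times> U \<in> sets lebesgue" using s by simp
    show "U \<times> {0..1} \<union> {0..1} \<times> U \<subseteq> {0..1} \<times> {0..1}"
      "A \<times> {0..1} \<subseteq> U \<times> {0..1} \<union> {0..1} \<times> U" "{0..1} \<times> A \<subseteq> U \<times> {0..1} \<union> {0..1} \<times> U"
      using U by auto
    show "measure lebesgue (U \<times> {0..1} \<union> {0..1} \<times> U) \<le> 2 * measure unit_leb A"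
      using measure_Un_le[OF s] m by simp
  qed
qed

section \<open>Choice of the parameters and of the exceptional sets\<close>

theorem theorem5p2:
  fixes W :: "real \<Rightarrow> real \<Rightarrow> real" and g :: "real \<Rightarrow> real"
    and u :: "real \<Rightarrow> real \<Rightarrow> real" and un :: "nat \<Rightarrow> real \<Rightarrow> real \<Rightarrow> real"
    and D :: real
  assumes "voting_kernel W" and "g \<in> Linf"
    and "voting_solution W g u"
    and "\<And>n. n \<ge> 1 \<Longrightarrow> voting_solution (step_kernel W n) (step_fun g n) (un n)"
    and "reaches_consensus u {0..1}"
    and "D > 0"
  shows "\<forall>\<epsilon>>0. \<exists>T\<ge>0. \<forall>c>0. \<exists>S :: real \<Rightarrow> (real \<times> real) set.
           (\<forall>t\<in>{T..T + D}. S t \<subseteq> {0..1} \<times> {0..1} \<and> S t \<in> sets lebesgue \<and>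
              measure lebesgue (S t) < c\<^sup>2) \<and>
           (\<forall>\<^sub>F n in sequentially. \<forall>t\<in>{T..T + D}. \<forall>(x, y)\<in>{0..1} \<times> {0..1} - S t.
              \<bar>un n x t - un n y t\<bar> \<le> \<epsilon>)"
proof (intro allI impI)
  let ?Q = "{0..1} \<times> {0..1} :: (real \<times> real) set"
  have Q: "?Q \<in> sets lebesgue" by (intro sets_completionI_sets) (simp add: borel_Times)
  obtain K where K: "unit_kernel K"
    and WK: "AE p in lebesgue_on ?Q. W (fst p) (snd p) = K (fst p) (snd p)"
    using voting_kernel_borel_version[OF assms(1)] .
  interpret unit_kernel K by fact
  obtain B where g: "ess_bdd unit_leb B g" using Linf_ess_bdd[OF assms(2)] .
  have sol: "voting_solution K g u"
    by (rule voting_solution_kernel_cong[OF bounded_kernel AE_square_imp_AE_AE[OF WK] assms(3)])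
  have soln: "voting_solution (step_kernel K n) (step_fun g n) (un n)" if "1 \<le> n" for n
    using assms(4)[OF that] step_kernel_cong[OF assms(1) K WK] by simp
  fix \<epsilon> :: real
  assume \<epsilon>: "0 < \<epsilon>"
  \<comment> \<open>Seven errors of \<epsilon>/8 will add up: three at each of \<open>x\<close> and
    \<open>y\<close> between \<open>un n\<close> and \<open>u\<close>, and this one between the two
    values of \<open>u\<close>.\<close>
  have "\<forall>\<^sub>F t in at_top. esssup (lebesgue_on ?Q) (\<lambda>(x, y). ereal \<bar>u x t - u y t\<bar>) < ereal (\<epsilon> / 8)"
    using assms(5) unfolding reaches_consensus_def by (rule order_tendstoD) (use \<epsilon> in simp)
  then obtain T0 where T0:
    "\<And>t. T0 \<le> t \<Longrightarrow> esssup (lebesgue_on ?Q) (\<lambda>(x, y). ereal \<bar>u x t - u y t\<bar>) < ereal (\<epsilon> / 8)"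
    by (auto simp: eventually_at_top_linorder)
  \<comment> \<open>The equation describes the solution at nonnegative times only. \<open>T\<close>
    is fixed before \<open>c\<close> appears.\<close>
  define T where "T = max 0 T0"
  define T' where "T' = T + D"
  have T: "0 \<le> T" "T0 \<le> T" by (auto simp: T_def)
  have "(\<lambda>m. B * (exp (2 * T') - (\<Sum>k<m. (2 * T') ^ k / fact k))) \<longlonglongrightarrow> B * (exp (2 * T') - exp (2 * T'))"
  proof (intro tendsto_intros)
    show "(\<lambda>m. \<Sum>k<m. (2 * T') ^ k / fact k) \<longlonglongrightarrow> exp (2 * T')"
      using exp_converges[of "2 * T'"] by (simp add: sums_def divide_inverse mult.commute)
  qed
  then have "\<forall>\<^sub>F m in sequentially. B * (exp (2 * T') - (\<Sum>k<m. (2 * T') ^ k / fact k)) < \<epsilon> / 8"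
    by (rule order_tendstoD) (use \<epsilon> in simp)
  then obtain m where m: "B * (exp (2 * T') - (\<Sum>k<m. (2 * T') ^ k / fact k)) < \<epsilon> / 8"
    by (auto simp: eventually_sequentially)
  let ?P = "voting_taylor unit_leb K g m"
    and ?Pn = "\<lambda>n. voting_taylor unit_leb (step_kernel K n) (step_fun g n) m"
  have taylor: "AE x in unit_leb. \<bar>u x t - ?P t x\<bar> \<le> \<epsilon> / 8" if "0 \<le> t" "t \<le> T'" for t
    using voting_solution_taylor[OF bounded_kernel sol g that, of m] m
    by (auto elim!: eventually_mono)
  have taylorn: "AE x in unit_leb. \<bar>un n x t - ?Pn n t x\<bar> \<le> \<epsilon> / 8"
    if "1 \<le> n" "0 \<le> t" "t \<le> T'" for n t
  proof -
    interpret S: unit_kernel "step_kernel K n" by (rule unit_kernel_step_kernel)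
    show ?thesis
      using voting_solution_taylor[OF S.bounded_kernel soln[OF that(1)] ess_bdd_step_fun[OF g] that(2,3), of m] m
      by (auto elim!: eventually_mono)
  qed
  \<comment> \<open>A majorant of the difference of the Taylor polynomials with \<open>t\<close>
    replaced by the end of the interval. Being free of \<open>t\<close>, it yields one Egorov set
    for all times.\<close>
  define r where "r n x = (\<Sum>k<m. T' ^ k / fact k *
      \<bar>(voting_op unit_leb (step_kernel K n) ^^ k) (step_fun g n) x - (voting_op unit_leb K ^^ k) g x\<bar>)"
    for n x
  have r_bound: "\<bar>?Pn n t x - ?P t x\<bar> \<le> r n x" if t: "0 \<le> t" "t \<le> T'" for n t x
  proof -
    have "?Pn n t x - ?P t x = (\<Sum>k<m. t ^ k / fact k *
        ((voting_op unit_leb (step_kernel K n) ^^ k) (step_fun g n) x - (voting_op unit_leb K ^^ k) g x))"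
      by (simp add: voting_taylor_def sum_subtractf right_diff_distrib)
    also have "\<bar>\<dots>\<bar> \<le> r n x"
      unfolding r_def using t
      by (intro order_trans[OF sum_abs] sum_mono)
        (auto simp: abs_mult intro!: mult_right_mono divide_right_mono power_mono)
    finally show ?thesis .
  qed
  have r_meas: "r n \<in> borel_measurable unit_leb" for n
  proof -
    interpret S: unit_kernel "step_kernel K n" by (rule unit_kernel_step_kernel)
    show ?thesis
      unfolding r_def
      by (intro borel_measurable_sum borel_measurable_times borel_measurable_const borel_measurable_abs
          borel_measurable_diff ess_bdd_measurable[OF ess_bdd_voting_op_funpow[OF g]]
          ess_bdd_measurable[OF S.ess_bdd_voting_op_funpow[OF ess_bdd_step_fun[OF g]]])
  qed
  have r_lim: "AE x in unit_leb. (\<lambda>n. r n x) \<longlonglongrightarrow> 0"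
  proof -
    have "AE x in unit_leb. \<forall>k. (\<lambda>n. (voting_op unit_leb (step_kernel K n) ^^ k) (step_fun g n) x)
        \<longlonglongrightarrow> (voting_op unit_leb K ^^ k) g x"
      using voting_op_funpow_step_tendsto[OF g] by (simp add: AE_all_countable)
    then show ?thesis
    proof eventually_elim
      case (elim x)
      have "(\<lambda>n. T' ^ k / fact k * \<bar>(voting_op unit_leb (step_kernel K n) ^^ k) (step_fun g n) x
          - (voting_op unit_leb K ^^ k) g x\<bar>) \<longlonglongrightarrow> T' ^ k / fact k * 0" for k
        using elim by (intro tendsto_mult_left tendsto_rabs_zero LIM_zero) blast
      then show ?case unfolding r_def by (intro tendsto_null_sum) simp
    qed
  qed
  show "\<exists>T\<ge>0. \<forall>c>0. \<exists>S :: real \<Rightarrow> (real \<times> real) set.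
           (\<forall>t\<in>{T..T + D}. S t \<subseteq> ?Q \<and> S t \<in> sets lebesgue \<and> measure lebesgue (S t) < c\<^sup>2) \<and>
           (\<forall>\<^sub>F n in sequentially. \<forall>t\<in>{T..T + D}. \<forall>(x, y)\<in>?Q - S t. \<bar>un n x t - un n y t\<bar> \<le> \<epsilon>)"
  proof (intro exI[of _ T] conjI T allI impI)
    fix c :: real
    assume c: "0 < c"
    \<comment> \<open>\<open>c\<^sup>2 / 2\<close> because the two cylinders over \<open>X\<close>
      double the measure.\<close>
    obtain X N where X: "X \<in> sets unit_leb" "measure unit_leb X < c\<^sup>2 / 2"
      "\<And>n x. N \<le> n \<Longrightarrow> x \<in> space unit_leb - X \<Longrightarrow> \<bar>r n x\<bar> \<le> \<epsilon> / 8"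
      using unit_leb.AE_tendsto_0_uniformly[OF r_meas r_lim, of "\<epsilon> / 8" "c\<^sup>2 / 2"] \<epsilon> c by auto
    \<comment> \<open>The threshold \<open>max 1 N\<close> is independent of \<open>t\<close>, as
      the theorem demands. The set must depend on \<open>t\<close>: the null sets below cannot be
      united over uncountably many times.\<close>
    have "\<exists>S. S \<subseteq> ?Q \<and> S \<in> sets lebesgue \<and> measure lebesgue S < c\<^sup>2 \<and>
        (\<forall>n\<ge>max 1 N. \<forall>(x, y)\<in>?Q - S. \<bar>un n x t - un n y t\<bar> \<le> \<epsilon>)" if t: "t \<in> {T..T + D}" for t
    proof -
      have t': "0 \<le> t" "t \<le> T'" "T0 \<le> t" using t T by (auto simp: T'_def)
      have "AE x in unit_leb. (\<forall>n\<in>{1..}. \<bar>un n x t - ?Pn n t x\<bar> \<le> \<epsilon> / 8) \<and> \<bar>u x t - ?P t x\<bar> \<le> \<epsilon> / 8"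
        using taylor taylorn t' by (simp add: AE_ball_countable)
      \<comment> \<open>One null set for all \<open>n \<ge> 1\<close> simultaneously, so that the
        exceptional set does not depend on \<open>n\<close>.\<close>
      then obtain Z where Z: "Z \<in> null_sets unit_leb"
        "\<And>n x. 1 \<le> n \<Longrightarrow> x \<in> space unit_leb - Z \<Longrightarrow> \<bar>un n x t - ?Pn n t x\<bar> \<le> \<epsilon> / 8"
        "\<And>x. x \<in> space unit_leb - Z \<Longrightarrow> \<bar>u x t - ?P t x\<bar> \<le> \<epsilon> / 8"
        unfolding eventually_ae_filter by blast
      have "AE p in lebesgue_on ?Q. \<bar>u (fst p) t - u (snd p) t\<bar> \<le> \<epsilon> / 8"
        using esssup_AE[of "\<lambda>(x, y). ereal \<bar>u x t - u y t\<bar>" "lebesgue_on ?Q"]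
      proof eventually_elim
        case (elim p)
        from le_less_trans[OF elim T0[OF t'(3)]] show ?case by (cases p) simp
      qed
      \<comment> \<open>Consensus is an essential supremum over pairs, so its null set lies in the
        square and need not come from bad points of the interval.\<close>
      then obtain Y where Y: "Y \<in> null_sets (lebesgue_on ?Q)"
        "{p \<in> space (lebesgue_on ?Q). \<not> \<bar>u (fst p) t - u (snd p) t\<bar> \<le> \<epsilon> / 8} \<subseteq> Y"
        unfolding eventually_ae_filter by blast
      then have Y_close: "\<bar>u x t - u y t\<bar> \<le> \<epsilon> / 8" if "(x, y) \<in> ?Q - Y" for x y
        using that by fastforce
      have Y': "Y \<subseteq> ?Q" "Y \<in> null_sets lebesgue"
        using Y(1) null_sets_restrict_space[OF Q] by auto
      have XZ: "X \<union> Z \<in> sets unit_leb" using X(1) Z(1) by auto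
      obtain C where C: "C \<in> sets lebesgue" "C \<subseteq> ?Q" "(X \<union> Z) \<times> {0..1} \<subseteq> C"
        "{0..1} \<times> (X \<union> Z) \<subseteq> C" "measure lebesgue C \<le> 2 * measure unit_leb (X \<union> Z)"
        using unit_leb_cylinders_cover[OF XZ] .
      show ?thesis
      proof (intro exI[of _ "C \<union> Y"] conjI allI impI)
        show "C \<union> Y \<subseteq> ?Q" using C Y' by simp
        show "C \<union> Y \<in> sets lebesgue" using C Y' by auto
        show "measure lebesgue (C \<union> Y) < c\<^sup>2"
          using C(1,5) Y' X(1,2) Z(1) by (simp add: measure_Un_null_set)
        fix n
        assume n: "max 1 N \<le> n"
        have "\<bar>un n x t - un n y t\<bar> \<le> \<epsilon>" if "(x, y) \<in> ?Q - (C \<union> Y)" for x y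
        proof -
          have "x \<notin> X \<union> Z" "y \<notin> X \<union> Z" using that C(3,4) by blast+
          then have xy: "x \<in> {0..1} - X" "y \<in> {0..1} - X" "x \<in> {0..1} - Z" "y \<in> {0..1} - Z"
            using that by auto
          \<comment> \<open>From \<open>un n\<close> to its Taylor polynomial, from there to the
            polynomial of \<open>u\<close> by \<open>r\<close>, and on to \<open>u\<close>.\<close>
          have near: "\<bar>un n z t - u z t\<bar> \<le> 3 * \<epsilon> / 8" if "z \<in> {0..1} - X" "z \<in> {0..1} - Z" for z
          proof -
            have "\<bar>un n z t - ?Pn n t z\<bar> \<le> \<epsilon> / 8" "\<bar>u z t - ?P t z\<bar> \<le> \<epsilon> / 8" "\<bar>r n z\<bar> \<le> \<epsilon> / 8"
              using Z(2)[of n z] Z(3)[of z] X(3)[of n z] n that by auto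
            then show ?thesis using r_bound[OF t'(1,2), of n z] by linarith
          qed
          have "\<bar>u x t - u y t\<bar> \<le> \<epsilon> / 8" using Y_close[of x y] that by simp
          with near[OF xy(1,3)] near[OF xy(2,4)] \<epsilon> show ?thesis by linarith
        qed
        then show "\<forall>(x, y)\<in>?Q - (C \<union> Y). \<bar>un n x t - un n y t\<bar> \<le> \<epsilon>" by blast
      qed
    qed
    then obtain S where S: "\<And>t. t \<in> {T..T + D} \<Longrightarrow> S t \<subseteq> ?Q \<and> S t \<in> sets lebesgue \<and>
        measure lebesgue (S t) < c\<^sup>2 \<and>
        (\<forall>n\<ge>max 1 N. \<forall>(x, y)\<in>?Q - S t. \<bar>un n x t - un n y t\<bar> \<le> \<epsilon>)"
      by metis
    show "\<exists>S :: real \<Rightarrow> (real \<times> real) set.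
           (\<forall>t\<in>{T..T + D}. S t \<subseteq> ?Q \<and> S t \<in> sets lebesgue \<and> measure lebesgue (S t) < c\<^sup>2) \<and>
           (\<forall>\<^sub>F n in sequentially. \<forall>t\<in>{T..T + D}. \<forall>(x, y)\<in>?Q - S t. \<bar>un n x t - un n y t\<bar> \<le> \<epsilon>)"
    proof (intro exI[of _ S] conjI eventually_sequentiallyI[of "max 1 N"])
      show "\<forall>t\<in>{T..T + D}. S t \<subseteq> ?Q \<and> S t \<in> sets lebesgue \<and> measure lebesgue (S t) < c\<^sup>2"
        using S by blast
      show "\<forall>t\<in>{T..T + D}. \<forall>(x, y)\<in>?Q - S t. \<bar>un n x t - un n y t\<bar> \<le> \<epsilon>" if "max 1 N \<le> n" for n
        using S that by blast
    qed
  qed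
qed

end
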